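(* Let $M>0$ and let $v$ be a measurable $m_1\times m_2$ matrix function on $[0,\infty)$ such that $\|v(x)\|\le M$ for $x\in\mathbb{R}_+$. Consider the skew-self-adjoint Dirac system with potential $v$ on $[0,\infty)$, with normalized fundamental solution $u(x,z)$. Then the sets $\mathcal{N}(x,z)$ ($x\ge 0$) are well-defined for $z\in\mathbb{C}_M$ (that is, for every $\mathcal{P}\in\mathbf{P}_{\ge}(j,\mathbb{C}_M)$ the matrix $\begin{bmatrix} I_{m_1}&0\end{bmatrix}u(x,z)^{-1}\mathcal{P}(z)$ is invertible at the points $z\in\mathbb{C}_M$ where $\mathcal{P}$ satisfies its defining inequalities). There is a unique matrix function $\varphi(z)$ such that $$\{\varphi(z)\}=\bigcap_{x<\infty}\mathcal{N}(x,z)\qquad (z\in\mathbb{C}_M).$$ This function is analytic and non-expansive (i.e. $\varphi(z)^*\varphi(z)\le I_{m_1}$) in $\mathbb{C}_M$.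
   Context: Let $m_1,m_2$ be positive integers, $m=m_1+m_2$. The skew-self-adjoint Dirac system with potential $v$ (an $m_1\times m_2$ matrix function) is $$\frac{d}{dx}y(x,z)=(\mathrm{i}zj+jV(x))y(x,z)\quad(x\ge 0),\qquad j=\begin{bmatrix} I_{m_1}&0\\ 0&-I_{m_2}\end{bmatrix},\quad V=\begin{bmatrix}0&v\\ v^*&0\end{bmatrix}.$$ Its $m\times m$ fundamental solution $u(x,z)$ is normalized by $u(0,z)=I_m$. $\|\cdot\|$ is the operator norm induced by the $\ell^2$-norms. $\mathbb{C}_M=\{z\in\mathbb{C}:\Im z>M\}$. $\mathbf{P}_{\ge}(j,\mathbb{C}_M)$ is the class of $m\times m_1$ matrix functions $\mathcal{P}(z)$, meromorphic in $\mathbb{C}_M$, such that, excluding possibly a discrete set of points, $\mathcal{P}(z)^*\mathcal{P}(z)>0$ and $\mathcal{P}(z)^*j\mathcal{P}(z)\ge 0$ for $z\in\mathbb{C}_M$. For fixed $x,z$, $\mathcal{N}(x,z)$ is the set of values at $(x,z)$ of the $m_2\times m_1$ matrix functions $$\varphi(x,z,\mathcal{P})=\begin{bmatrix}0&I_{m_2}\end{bmatrix}u(x,z)^{-1}\mathcal{P}(z)\Big(\begin{bmatrix}I_{m_1}&0\end{bmatrix}u(x,z)^{-1}\mathcal{P}(z)\Big)^{-1},\qquad \mathcal{P}\in\mathbf{P}_{\ge}(j,\mathbb{C}_M),$$ with removable singularities in $z$ removed. *)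

theory Defs
  imports "HOL-Complex_Analysis.Complex_Analysis" "HOL-Library.Complex_Order"
begin

text \<open>
  The index types \<open>'a\<close> and \<open>'b\<close> have \<open>m\<^sub>1\<close> and \<open>m\<^sub>2\<close> elements; \<open>m \<times> m\<close> matrices are
  indexed by \<open>'a + 'b\<close>. In \<open>complex^'c^'r\<close> the rows are indexed by \<open>'r\<close> and the columns
  by \<open>'c\<close>, so an \<open>m\<^sub>1 \<times> m\<^sub>2\<close> matrix has type \<open>complex^'b^'a\<close>.
\<close>

definition ctranspose :: "complex^'c^'r \<Rightarrow> complex^'r^'c" where
  "ctranspose A = (\<chi> i k. cnj (A $ k $ i))"

definition cform :: "complex^'n^'n \<Rightarrow> complex^'n \<Rightarrow> complex" where
  "cform A f = (\<Sum>i\<in>UNIV. \<Sum>k\<in>UNIV. cnj (f $ i) * A $ i $ k * f $ k)"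

text \<open>In the order of \<open>Complex_Order\<close>, \<open>0 \<le> c\<close> and \<open>0 < c\<close> include that \<open>c\<close> is real.\<close>

definition pos_semidef :: "complex^'n^'n \<Rightarrow> bool" where
  "pos_semidef A \<longleftrightarrow> (\<forall>f. 0 \<le> cform A f)"

definition pos_def :: "complex^'n^'n \<Rightarrow> bool" where
  "pos_def A \<longleftrightarrow> (\<forall>f. f \<noteq> 0 \<longrightarrow> 0 < cform A f)"

definition block_row :: "complex^'a^'r \<Rightarrow> complex^'b^'r \<Rightarrow> complex^('a + 'b)^'r" where
  "block_row A B = (\<chi> r c. case c of Inl i \<Rightarrow> A $ r $ i | Inr k \<Rightarrow> B $ r $ k)"

definition block_matrix ::
  "complex^'a^'a \<Rightarrow> complex^'b^'a \<Rightarrow> complex^'a^'b \<Rightarrow> complex^'b^'b \<Rightarrow>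
    complex^('a + 'b)^('a + 'b)" where
  "block_matrix A B C D =
    (\<chi> r. case r of Inl i \<Rightarrow> block_row A B $ i | Inr k \<Rightarrow> block_row C D $ k)"

definition jmat :: "complex^('a::finite + 'b::finite)^('a + 'b)" where
  "jmat = block_matrix (mat 1) 0 0 (- mat 1)"

definition Vmat :: "complex^'b^'a \<Rightarrow> complex^('a::finite + 'b::finite)^('a + 'b)" where
  "Vmat v = block_matrix 0 v (ctranspose v) 0"

definition upper_halfplane :: "real \<Rightarrow> complex set" where
  "upper_halfplane M = {z. Im z > M}"

text \<open>
  The families \<open>d\<close> with \<open>d division_of S\<close> and \<open>S \<subseteq> {a..b}\<close> are the finite families of
  non-overlapping non-empty closed subintervals \<open>{Inf K..Sup K}\<close> of \<open>{a..b}\<close>.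
\<close>

definition abs_continuous_on_interval ::
  "real \<Rightarrow> real \<Rightarrow> (real \<Rightarrow> 'e::real_normed_vector) \<Rightarrow> bool" where
  "abs_continuous_on_interval a b f \<longleftrightarrow>
    (\<forall>\<epsilon>>0. \<exists>\<delta>>0. \<forall>d S. d division_of S \<and> S \<subseteq> {a..b} \<and> (\<Sum>K\<in>d. Sup K - Inf K) < \<delta> \<longrightarrow>
      (\<Sum>K\<in>d. norm (f (Sup K) - f (Inf K))) < \<epsilon>)"

text \<open>
  As \<open>v\<close> is only measurable, solutions on \<open>[0,\<infinity>)\<close> are meant in the sense of Caratheodory:
  locally absolutely continuous functions satisfying the equation almost everywhere.
  Values of \<open>u\<close> at negative \<open>x\<close> play no role.
\<close>

definition fundamental_solution ::
  "(real \<Rightarrow> complex^'b^'a) \<Rightarrow> (real \<Rightarrow> complex \<Rightarrow> complex^('a::finite + 'b::finite)^('a + 'b)) \<Rightarrow> bool"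
  where
  "fundamental_solution v u \<longleftrightarrow>
    (\<forall>z. u 0 z = mat 1 \<and>
      (\<forall>b\<ge>0. abs_continuous_on_interval 0 b (\<lambda>x. u x z)) \<and>
      (AE x in lebesgue_on {0..}.
        ((\<lambda>x. u x z) has_vector_derivative
          (mat (\<i> * z) ** jmat + jmat ** Vmat (v x)) ** u x z) (at x within {0..})))"

definition P_ineq :: "complex^'a^('a::finite + 'b::finite) \<Rightarrow> bool" where
  "P_ineq Q \<longleftrightarrow> pos_def (ctranspose Q ** Q) \<and> pos_semidef (ctranspose Q ** jmat ** Q)"

text \<open>
  \<open>meromorphic_on\<close> permits arbitrary values on an exceptional set without accumulation points
  in the domain; the inequalities are likewise required outside of such a set.
\<close>

definition P_class :: "real \<Rightarrow> (complex \<Rightarrow> complex^'a^('a::finite + 'b::finite)) set" where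
  "P_class M =
    {P. (\<forall>i k. (\<lambda>z. P z $ i $ k) meromorphic_on upper_halfplane M) \<and>
        (\<forall>\<^sub>\<approx>z\<in>upper_halfplane M. P_ineq (P z))}"

definition upper_part ::
  "complex^('a + 'b)^('a + 'b) \<Rightarrow> complex^'a^('a::finite + 'b::finite) \<Rightarrow> complex^'a^'a" where
  "upper_part U Q = block_row (mat 1) 0 ** matrix_inv U ** Q"

definition lower_part ::
  "complex^('a + 'b)^('a + 'b) \<Rightarrow> complex^'a^('a::finite + 'b::finite) \<Rightarrow> complex^'a^'b" where
  "lower_part U Q = block_row 0 (mat 1) ** matrix_inv U ** Q"

definition phi ::
  "(real \<Rightarrow> complex \<Rightarrow> complex^('a + 'b)^('a + 'b)) \<Rightarrow> real \<Rightarrow> complex \<Rightarrow>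
    (complex \<Rightarrow> complex^'a^('a::finite + 'b::finite)) \<Rightarrow> complex^'a^'b" where
  "phi u x z P = lower_part (u x z) (P z) ** matrix_inv (upper_part (u x z) (P z))"

definition N_set ::
  "real \<Rightarrow> (real \<Rightarrow> complex \<Rightarrow> complex^('a::finite + 'b::finite)^('a + 'b)) \<Rightarrow>
    real \<Rightarrow> complex \<Rightarrow> (complex^'a^'b) set" where
  "N_set M u x z =
    {(\<chi> i k. remove_sings (\<lambda>\<zeta>. phi u x \<zeta> P $ i $ k) z) | P. P \<in> P_class M}"

end

theory Submission
  imports Defs
begin

text \<open>
  Along a solution \<open>y\<close> one has \<open>(y\<^sup>*jy)' \<le> -2 (\<Im> z - M) y\<^sup>*y\<close> almost everywhere, so \<open>u(x,z)\<close> is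
  \<open>j\<close>-contractive for \<open>\<Im> z > M\<close>, and \<open>\<N>(x,z)\<close> is the set of all \<open>\<phi>\<close> such that \<open>j\<close> is
  nonnegative on the range of \<open>u(x,z) [I; \<phi>]\<close>: each such \<open>\<phi>\<close> is attained by a constant \<open>\<P>\<close>,
  and conversely the singularities are removable because the values are contractions. These sets
  are compact and decrease in \<open>x\<close>. Two points \<open>\<phi>, \<psi>\<close> of the intersection yield square integrable
  solutions \<open>u [I; \<phi>] f\<close> and \<open>u [I; \<psi>] f\<close>, whereas their difference starts \<open>j\<close>-negative and hence
  stays bounded away from zero unless it vanishes. The intersection point is analytic in \<open>z\<close> by
  Montel's theorem.
\<close>

text \<open>Invertibility of \<open>u\<close> and its analyticity in \<open>z\<close> have to be
  extracted from a definition that treats one \<open>z\<close> at a time, with an exceptional null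
  set depending on \<open>z\<close>. Both come from the product
  \<open>ctranspose (u x (cnj z0)) ** u x z\<close>. The coefficient at \<open>cnj z0\<close> is
  minus the adjoint of the one at \<open>z0\<close>, so the potential cancels in the derivative of
  the product and only a multiple of \<open>z - z0\<close> is left: for \<open>z = z0\<close> the
  product is constant, which yields the inverse, and for \<open>z\<close> near \<open>z0\<close> it
  can be expanded to first order. Analyticity matters because the value at a singularity is a limit
  of points in the discs at nearby spectral parameters, so the discs must depend continuously on
  them. The threshold \<open>M\<close> is where two terms balance: up to a common factor 2, the
  spectral term contributes - Im z |y|^2 to the derivative of the indefinite form, and the potential
  at most 2 M |p| |q| \<le> M |y|^2 for y = (p, q). The strict gap Im z - M is what shrinks the
  intersection to a point. Estimates along solutions are expressed as sign conditions on almost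
  everywhere derivatives, so that no integral of |y|^2 is formed.\<close>

unbundle no fps_syntax

section \<open>Absolutely continuous functions\<close>

lemma abs_continuous_on_intervalE:
  assumes "abs_continuous_on_interval a b f" "\<epsilon> > 0"
  obtains \<delta> where "\<delta> > 0" "\<And>d S. d division_of S \<Longrightarrow> S \<subseteq> {a..b} \<Longrightarrow>
      (\<Sum>K\<in>d. Sup K - Inf K) < \<delta> \<Longrightarrow> (\<Sum>K\<in>d. norm (f (Sup K) - f (Inf K))) < \<epsilon>"
proof -
  obtain \<delta> where "\<delta> > 0" and *: "\<forall>d S. d division_of S \<and> S \<subseteq> {a..b} \<and>
      (\<Sum>K\<in>d. Sup K - Inf K) < \<delta> \<longrightarrow> (\<Sum>K\<in>d. norm (f (Sup K) - f (Inf K))) < \<epsilon>"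
    using assms(1)[unfolded abs_continuous_on_interval_def, rule_format, OF assms(2)] by (elim exE conjE)
  show ?thesis by (rule that[OF \<open>\<delta> > 0\<close> *[rule_format]]) (intro conjI)
qed

lemma abs_continuous_on_interval_subset:
  assumes "abs_continuous_on_interval a b f" "a \<le> c" "d \<le> b"
  shows "abs_continuous_on_interval c d f"
  unfolding abs_continuous_on_interval_def
proof (intro allI impI)
  fix \<epsilon> :: real assume "\<epsilon> > 0"
  obtain \<delta> where \<delta>: "\<delta> > 0" "\<And>d S. d division_of S \<Longrightarrow> S \<subseteq> {a..b} \<Longrightarrow>
      (\<Sum>K\<in>d. Sup K - Inf K) < \<delta> \<Longrightarrow> (\<Sum>K\<in>d. norm (f (Sup K) - f (Inf K))) < \<epsilon>"
    by (rule abs_continuous_on_intervalE[OF assms(1) \<open>\<epsilon> > 0\<close>]) blast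
  have "{c..d} \<subseteq> {a..b}" using assms by auto
  then show "\<exists>\<delta>>0. \<forall>da S. da division_of S \<and> S \<subseteq> {c..d} \<and> (\<Sum>K\<in>da. Sup K - Inf K) < \<delta> \<longrightarrow>
      (\<Sum>K\<in>da. norm (f (Sup K) - f (Inf K))) < \<epsilon>"
    by (intro exI[of _ \<delta>] conjI allI impI \<delta>(1), elim conjE, intro \<delta>(2)) (auto intro: order_trans)
qed

lemma abs_continuous_on_intervalD1:
  assumes "abs_continuous_on_interval a b f" "\<epsilon> > 0"
  obtains \<delta> where "\<delta> > 0"
    "\<And>s t. a \<le> s \<Longrightarrow> s \<le> t \<Longrightarrow> t \<le> b \<Longrightarrow> t - s < \<delta> \<Longrightarrow> norm (f t - f s) < \<epsilon>"
proof -
  obtain \<delta> where \<delta>: "\<delta> > 0" "\<And>d S. d division_of S \<Longrightarrow> S \<subseteq> {a..b} \<Longrightarrow>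
      (\<Sum>K\<in>d. Sup K - Inf K) < \<delta> \<Longrightarrow> (\<Sum>K\<in>d. norm (f (Sup K) - f (Inf K))) < \<epsilon>"
    by (rule abs_continuous_on_intervalE[OF assms]) blast
  show ?thesis
  proof (rule that[OF \<delta>(1)])
    fix s t assume st: "a \<le> s" "s \<le> t" "t \<le> b" "t - s < \<delta>"
    have "{{s..t}} division_of {s..t}"
      using st division_of_self[of s t] by (simp add: cbox_interval)
    from \<delta>(2)[OF this] st show "norm (f t - f s) < \<epsilon>" by simp
  qed
qed

lemma abs_continuous_on_interval_imp_continuous_on:
  assumes "abs_continuous_on_interval a b f"
  shows "continuous_on {a..b} f"
  unfolding continuous_on_iff
proof (intro ballI allI impI)
  fix x \<epsilon> :: real assume x: "x \<in> {a..b}" and "\<epsilon> > 0"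
  then obtain \<delta> where \<delta>: "\<delta> > 0"
    "\<And>s t. a \<le> s \<Longrightarrow> s \<le> t \<Longrightarrow> t \<le> b \<Longrightarrow> t - s < \<delta> \<Longrightarrow> norm (f t - f s) < \<epsilon>"
    using abs_continuous_on_intervalD1[OF assms] by metis
  have "dist (f y) (f x) < \<epsilon>" if "y \<in> {a..b}" "dist y x < \<delta>" for y
    using \<delta>(2)[of x y] \<delta>(2)[of y x] that x
    by (cases "x \<le> y") (auto simp: dist_norm norm_minus_commute)
  with \<delta>(1) show "\<exists>d>0. \<forall>x'\<in>{a..b}. dist x' x < d \<longrightarrow> dist (f x') (f x) < \<epsilon>" by blast
qed

lemma abs_continuous_on_interval_bounded:
  fixes f :: "real \<Rightarrow> 'e::real_normed_vector"
  assumes "abs_continuous_on_interval a b f"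
  obtains C where "C > 0" "\<And>x. x \<in> {a..b} \<Longrightarrow> norm (f x) \<le> C"
proof -
  have "bounded (f ` {a..b})"
    using abs_continuous_on_interval_imp_continuous_on[OF assms]
    by (intro compact_imp_bounded compact_continuous_image) auto
  then show ?thesis using that unfolding bounded_pos by auto
qed

lemma division_of_real_endpoints:
  fixes d :: "real set set"
  assumes "d division_of S" "S \<subseteq> {a..b}" "K \<in> d"
  shows "Inf K \<in> {a..b}" "Sup K \<in> {a..b}" "Inf K \<le> Sup K" "K = {Inf K..Sup K}"
proof -
  obtain s t where st: "K = {s..t}" "K \<noteq> {}" "K \<subseteq> S"
    using division_ofD[OF assms(1)] assms(3) by (metis cbox_interval)
  then have "s \<le> t" by simp
  with st have "Inf K = s" "Sup K = t" by auto
  then show "Inf K \<in> {a..b}" "Sup K \<in> {a..b}" "Inf K \<le> Sup K" "K = {Inf K..Sup K}"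
    using st(1,3) assms(2) \<open>s \<le> t\<close> by (simp_all add: subset_iff)
qed

section \<open>Closure properties of absolutely continuous functions\<close>

lemma abs_continuous_on_interval_lipschitz:
  assumes "\<And>s t. s \<in> {a..b} \<Longrightarrow> t \<in> {a..b} \<Longrightarrow> norm (f t - f s) \<le> L * \<bar>t - s\<bar>"
  shows "abs_continuous_on_interval a b f"
  unfolding abs_continuous_on_interval_def
proof (intro allI impI)
  fix \<epsilon> :: real assume "\<epsilon> > 0"
  have "(\<Sum>K\<in>d. norm (f (Sup K) - f (Inf K))) < \<epsilon>"
    \<comment> \<open>\<open>L\<close> may be zero or negative; \<bar>L\<bar> + 1 is a positive
      Lipschitz constant to divide by.\<close>
    if d: "d division_of S" "S \<subseteq> {a..b}" "(\<Sum>K\<in>d. Sup K - Inf K) < \<epsilon> / (\<bar>L\<bar> + 1)" for d S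
  proof -
    have "(\<Sum>K\<in>d. norm (f (Sup K) - f (Inf K))) \<le> (\<Sum>K\<in>d. (\<bar>L\<bar> + 1) * (Sup K - Inf K))"
    proof (rule sum_mono)
      fix K assume "K \<in> d"
      note e = division_of_real_endpoints[OF d(1,2) this]
      have "norm (f (Sup K) - f (Inf K)) \<le> L * \<bar>Sup K - Inf K\<bar>" using assms e by blast
      also have "\<dots> \<le> (\<bar>L\<bar> + 1) * \<bar>Sup K - Inf K\<bar>" by (intro mult_right_mono) auto
      finally show "norm (f (Sup K) - f (Inf K)) \<le> (\<bar>L\<bar> + 1) * (Sup K - Inf K)" using e by simp
    qed
    also have "\<dots> = (\<bar>L\<bar> + 1) * (\<Sum>K\<in>d. Sup K - Inf K)" by (simp add: sum_distrib_left)
    also have "\<dots> < \<epsilon>" using d(3) by (simp add: field_simps)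
    finally show ?thesis .
  qed
  moreover have "\<epsilon> / (\<bar>L\<bar> + 1) > 0" using \<open>\<epsilon> > 0\<close> by simp
  ultimately show "\<exists>\<delta>>0. \<forall>d S. d division_of S \<and> S \<subseteq> {a..b} \<and> (\<Sum>K\<in>d. Sup K - Inf K) < \<delta> \<longrightarrow>
      (\<Sum>K\<in>d. norm (f (Sup K) - f (Inf K))) < \<epsilon>"
    by (intro exI[of _ "\<epsilon> / (\<bar>L\<bar> + 1)"] conjI allI impI) blast+
qed

text \<open>Only increments enter the definition, so a function whose increments are controlled by
  those of \<open>f\<close> and \<open>g\<close> inherits their smallness, each of the two getting
  half of \<epsilon>/C. Linear images, products and sums are instances.\<close>

lemma abs_continuous_on_interval_dominated:
  assumes "abs_continuous_on_interval a b f" "abs_continuous_on_interval a b g"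
    and "C > 0"
    and le: "\<And>s t. s \<in> {a..b} \<Longrightarrow> t \<in> {a..b} \<Longrightarrow>
      norm (h t - h s) \<le> C * (norm (f t - f s) + norm (g t - g s))"
  shows "abs_continuous_on_interval a b h"
  unfolding abs_continuous_on_interval_def
proof (intro allI impI)
  fix \<epsilon> :: real assume "\<epsilon> > 0"
  define \<eta> where "\<eta> = \<epsilon> / (2 * C)"
  have "\<eta> > 0" using \<open>\<epsilon> > 0\<close> \<open>C > 0\<close> by (simp add: \<eta>_def)
  obtain \<delta> where \<delta>: "\<delta> > 0" "\<And>d S. d division_of S \<Longrightarrow> S \<subseteq> {a..b} \<Longrightarrow>
      (\<Sum>K\<in>d. Sup K - Inf K) < \<delta> \<Longrightarrow> (\<Sum>K\<in>d. norm (f (Sup K) - f (Inf K))) < \<eta>"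
    by (rule abs_continuous_on_intervalE[OF assms(1) \<open>\<eta> > 0\<close>]) blast
  obtain \<gamma> where \<gamma>: "\<gamma> > 0" "\<And>d S. d division_of S \<Longrightarrow> S \<subseteq> {a..b} \<Longrightarrow>
      (\<Sum>K\<in>d. Sup K - Inf K) < \<gamma> \<Longrightarrow> (\<Sum>K\<in>d. norm (g (Sup K) - g (Inf K))) < \<eta>"
    by (rule abs_continuous_on_intervalE[OF assms(2) \<open>\<eta> > 0\<close>]) blast
  have "(\<Sum>K\<in>d. norm (h (Sup K) - h (Inf K))) < \<epsilon>"
    if d: "d division_of S" "S \<subseteq> {a..b}" "(\<Sum>K\<in>d. Sup K - Inf K) < min \<delta> \<gamma>" for d S
  proof -
    have "(\<Sum>K\<in>d. norm (h (Sup K) - h (Inf K))) \<le>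
        (\<Sum>K\<in>d. C * (norm (f (Sup K) - f (Inf K)) + norm (g (Sup K) - g (Inf K))))"
      using division_of_real_endpoints[OF d(1,2)] by (intro sum_mono le) auto
    also have "\<dots> = C * ((\<Sum>K\<in>d. norm (f (Sup K) - f (Inf K))) + (\<Sum>K\<in>d. norm (g (Sup K) - g (Inf K))))"
      by (simp add: sum_distrib_left sum.distrib algebra_simps)
    also have "\<dots> < C * (\<eta> + \<eta>)"
      using \<delta>(2)[OF d(1,2)] \<gamma>(2)[OF d(1,2)] d(3) \<open>C > 0\<close> by (intro mult_strict_left_mono add_strict_mono) auto
    also have "\<dots> = \<epsilon>" using \<open>C > 0\<close> by (simp add: \<eta>_def)
    finally show ?thesis .
  qed
  moreover have "min \<delta> \<gamma> > 0" using \<delta> \<gamma> by simp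
  ultimately show "\<exists>\<delta>>0. \<forall>d S. d division_of S \<and> S \<subseteq> {a..b} \<and> (\<Sum>K\<in>d. Sup K - Inf K) < \<delta> \<longrightarrow>
      (\<Sum>K\<in>d. norm (h (Sup K) - h (Inf K))) < \<epsilon>"
    by (intro exI[of _ "min \<delta> \<gamma>"] conjI allI impI) blast+
qed

lemma abs_continuous_on_interval_const: "abs_continuous_on_interval a b (\<lambda>x. c)"
  by (rule abs_continuous_on_interval_lipschitz[where L = 0]) simp

lemma abs_continuous_on_interval_linear:
  assumes "bounded_linear h" "abs_continuous_on_interval a b f"
  shows "abs_continuous_on_interval a b (\<lambda>x. h (f x))"
proof -
  interpret bounded_linear h by fact
  obtain C where "C > 0" "\<And>x. norm (h x) \<le> norm x * C" using pos_bounded by blast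
  then have "norm (h (f t) - h (f s)) \<le> C * (norm (f t - f s) + norm (f t - f s))" for s t
    using \<open>\<And>x. norm (h x) \<le> norm x * C\<close>[of "f t - f s"]
      mult_nonneg_nonneg[of C "norm (f t - f s)"] \<open>C > 0\<close>
    by (simp add: diff distrib_left mult.commute[of "norm _" C] del: mult_nonneg_nonneg)
  then show ?thesis
    by (intro abs_continuous_on_interval_dominated[OF assms(2) assms(2) \<open>C > 0\<close>]) blast
qed

text \<open>The increment of the product splits into two terms with one increment each, and the
  other factor is bounded on the compact interval. \<open>A + B\<close> serves as a common bound
  that fits the symmetric form of the domination lemma.\<close>

lemma abs_continuous_on_interval_bilinear:
  fixes f :: "real \<Rightarrow> 'c::real_normed_vector" and g :: "real \<Rightarrow> 'd::real_normed_vector"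
    and prd :: "'c \<Rightarrow> 'd \<Rightarrow> 'e::real_normed_vector"
  assumes "bounded_bilinear prd" "abs_continuous_on_interval a b f" "abs_continuous_on_interval a b g"
  shows "abs_continuous_on_interval a b (\<lambda>x. prd (f x) (g x))"
proof -
  interpret bounded_bilinear prd by fact
  obtain C where C: "C > 0" "\<And>x y. norm (prd x y) \<le> norm x * norm y * C" using pos_bounded by blast
  obtain A where A: "A > 0" "\<And>x. x \<in> {a..b} \<Longrightarrow> norm (f x) \<le> A"
    using abs_continuous_on_interval_bounded[OF assms(2)] by metis
  obtain B where B: "B > 0" "\<And>x. x \<in> {a..b} \<Longrightarrow> norm (g x) \<le> B"
    using abs_continuous_on_interval_bounded[OF assms(3)] by metis
  show ?thesis
  proof (rule abs_continuous_on_interval_dominated[OF assms(2,3)])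
    show "C * (A + B) > 0" using A B C by simp
    fix s t assume st: "s \<in> {a..b}" "t \<in> {a..b}"
    have "prd (f t) (g t) - prd (f s) (g s) = prd (f t) (g t - g s) + prd (f t - f s) (g s)"
      by (simp add: diff_left diff_right)
    then have "norm (prd (f t) (g t) - prd (f s) (g s)) \<le>
        norm (f t) * norm (g t - g s) * C + norm (f t - f s) * norm (g s) * C"
      by (metis norm_triangle_mono C(2))
    also have "\<dots> \<le> (A + B) * norm (g t - g s) * C + norm (f t - f s) * (A + B) * C"
      using A(2)[OF st(2)] B(2)[OF st(1)] A(1) B(1) C(1)
      by (intro add_mono mult_right_mono mult_left_mono) auto
    finally show "norm (prd (f t) (g t) - prd (f s) (g s)) \<le>
        C * (A + B) * (norm (f t - f s) + norm (g t - g s))"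
      by (simp add: algebra_simps)
  qed
qed

lemma abs_continuous_on_interval_add:
  assumes "abs_continuous_on_interval a b f" "abs_continuous_on_interval a b g"
  shows "abs_continuous_on_interval a b (\<lambda>x. f x + g x)"
  by (rule abs_continuous_on_interval_dominated[OF assms, of 1])
     (auto simp: norm_diff_triangle_ineq)

lemma abs_continuous_on_interval_diff:
  assumes "abs_continuous_on_interval a b f" "abs_continuous_on_interval a b g"
  shows "abs_continuous_on_interval a b (\<lambda>x. f x - g x)"
  using abs_continuous_on_interval_add[OF assms(1)
      abs_continuous_on_interval_linear[OF bounded_linear_minus[OF bounded_linear_ident] assms(2)]]
  by simp

text \<open>
  A gauge argument: near a tag outside of the exceptional null set the increment of \<open>f\<close> is
  controlled by the derivative; the intervals with a tag in the null set lie in an open set of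
  small measure, so that absolute continuity controls their contribution.
\<close>

lemma abs_continuous_deriv_nonpos_imp_le:
  fixes f :: "real \<Rightarrow> real"
  assumes ac: "abs_continuous_on_interval a b f" and "a \<le> b" and "negligible N"
    and deriv: "\<And>x. x \<in> {a..b} - N \<Longrightarrow> \<exists>D\<le>0. (f has_real_derivative D) (at x within {a..b})"
  shows "f b \<le> f a"
proof (rule field_le_epsilon)
  fix e :: real assume "e > 0"
  \<comment> \<open>The allowed error is shared out: intervals tagged outside \<open>N\<close> cost
    at most \<epsilon> (b - a) and those tagged in \<open>N\<close> at most \<epsilon>, which is
    what the \<open>+ 1\<close> pays for.\<close>
  define \<epsilon> where "\<epsilon> = e / (b - a + 1)"
  have "\<epsilon> * (b - a + 1) = e" using \<open>a \<le> b\<close> by (simp add: \<epsilon>_def)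
  then have \<epsilon>: "\<epsilon> > 0" "\<epsilon> * (b - a) + \<epsilon> = e"
    using \<open>e > 0\<close> \<open>a \<le> b\<close> by (auto simp: \<epsilon>_def distrib_left)
  obtain \<delta> where \<delta>: "\<delta> > 0" "\<And>d S. d division_of S \<Longrightarrow> S \<subseteq> {a..b} \<Longrightarrow>
      (\<Sum>K\<in>d. Sup K - Inf K) < \<delta> \<Longrightarrow> (\<Sum>K\<in>d. norm (f (Sup K) - f (Inf K))) < \<epsilon>"
    by (rule abs_continuous_on_intervalE[OF ac \<epsilon>(1)]) blast
  have "N \<in> sets lebesgue" using \<open>negligible N\<close> by (simp add: negligible_iff_null_sets null_setsD2)
  then obtain W where W: "open W" "N \<subseteq> W" "W - N \<in> lmeasurable" "emeasure lebesgue (W - N) < ennreal \<delta>"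
    using sets_lebesgue_outer_open[of N \<delta>] \<delta>(1) by metis
  have W_meas: "W \<in> lmeasurable"
    using W(2,3) \<open>negligible N\<close> 
    using fmeasurable.Un[OF negligible_imp_measurable, of N "W - N"]
    by (simp add: Un_absorb1)
  have "measure lebesgue W = measure lebesgue (W - N)"
    using W_meas \<open>negligible N\<close>
    by (simp add: measure_Diff_null_set negligible_iff_null_sets fmeasurableD)
  then have W_small: "measure lebesgue W < \<delta>"
    using W(3,4) \<delta>(1) by (simp add: emeasure_eq_measure2 ennreal_less_iff)
  have "\<exists>r>0. \<forall>s t. s \<in> {a..b} \<longrightarrow> t \<in> {a..b} \<longrightarrow> s \<le> x \<longrightarrow> x \<le> t \<longrightarrow> {s..t} \<subseteq> ball x r \<longrightarrow> f t - f s \<le> \<epsilon> * (t - s)"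
    if x: "x \<in> {a..b} - N" for x
  proof -
    obtain D where D: "D \<le> 0" "(f has_real_derivative D) (at x within {a..b})" using deriv[OF x] by blast
    then obtain r where r: "r > 0" "\<And>y. y \<in> {a..b} \<Longrightarrow> norm (y - x) < r \<Longrightarrow>
        norm (f y - f x - D * (y - x)) \<le> \<epsilon> * norm (y - x)"
      unfolding has_field_derivative_def has_derivative_within_alt using \<epsilon>(1) by metis
    have "f t - f s \<le> \<epsilon> * (t - s)"
      if st: "s \<in> {a..b}" "t \<in> {a..b}" "s \<le> x" "x \<le> t" "{s..t} \<subseteq> ball x r" for s t
    proof -
      have "s \<in> ball x r" "t \<in> ball x r" using st(3,4) subsetD[OF st(5)] by (simp_all del: mem_ball)
      then have "\<bar>f t - f x - D * (t - x)\<bar> \<le> \<epsilon> * (t - x)" "\<bar>f s - f x - D * (s - x)\<bar> \<le> \<epsilon> * (x - s)"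
        using r(2)[OF st(1)] r(2)[OF st(2)] st by (simp_all add: dist_real_def abs_minus_commute)
      moreover have "D * (t - x) \<le> 0" "D * (s - x) \<ge> 0"
        using D(1) st by (auto intro: mult_nonpos_nonneg mult_nonpos_nonpos)
      ultimately have "f t - f s \<le> \<epsilon> * (t - x) + \<epsilon> * (x - s)" by linarith
      then show ?thesis by (simp add: algebra_simps)
    qed
    with r(1) show ?thesis by blast
  qed
  then obtain r where r: "\<And>x. x \<in> {a..b} - N \<Longrightarrow> r x > 0"
    "\<And>x s t. x \<in> {a..b} - N \<Longrightarrow> s \<in> {a..b} \<Longrightarrow> t \<in> {a..b} \<Longrightarrow> s \<le> x \<Longrightarrow> x \<le> t \<Longrightarrow> {s..t} \<subseteq> ball x (r x) \<Longrightarrow>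
      f t - f s \<le> \<epsilon> * (t - s)"
    by metis
  define g where "g x = (if x \<in> N then W else if x \<in> {a..b} then ball x (r x) else ball x 1)" for x
  have "gauge g" unfolding gauge_def using W(1,2) r(1) by (auto simp: g_def)
  then obtain p where p: "p tagged_division_of {a..b}" "g fine p" using fine_division_exists_real by blast
  have fin: "finite p" using p(1) by blast
  have ends: "\<exists>s t. K = {s..t} \<and> s \<le> x \<and> x \<le> t \<and> a \<le> s \<and> t \<le> b" if "(x, K) \<in> p" for x K
    using tagged_division_ofD[OF p(1)] that by (metis atLeastAtMost_iff atLeastatMost_subset_iff cbox_interval order_trans)
  define q where "q = {(x, K) \<in> p. x \<in> N}"
  have q: "q \<subseteq> p" by (auto simp: q_def)
  have "(\<Sum>(x,K)\<in>p - q. f (Sup K) - f (Inf K)) \<le> (\<Sum>(x,K)\<in>p - q. \<epsilon> * (Sup K - Inf K))"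
  proof (rule sum_mono, clarify)
    fix x K assume xK: "(x, K) \<in> p" "(x, K) \<notin> q"
    obtain s t where st: "K = {s..t}" "s \<le> x" "x \<le> t" "a \<le> s" "t \<le> b" using ends[OF xK(1)] by blast
    have "K \<subseteq> g x" using p(2) xK unfolding fine_def by blast
    moreover have "x \<in> {a..b} - N" using xK st by (auto simp: q_def)
    ultimately show "f (Sup K) - f (Inf K) \<le> \<epsilon> * (Sup K - Inf K)"
      using r(2)[of x s t] st by (auto simp: g_def)
  qed
  also have "\<dots> \<le> (\<Sum>(x,K)\<in>p. \<epsilon> * (Sup K - Inf K))"
  proof (rule sum_mono2[OF fin])
    fix y assume "y \<in> p - (p - q)"
    moreover obtain x K where "y = (x, K)" by force
    ultimately obtain s t where "y = (x, {s..t})" "s \<le> x" "x \<le> t" using ends by blast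
    then show "0 \<le> (case y of (x, K) \<Rightarrow> \<epsilon> * (Sup K - Inf K))" using \<epsilon>(1) by simp
  qed blast
  also have "\<dots> = \<epsilon> * (\<Sum>(x,K)\<in>p. Sup K - Inf K)"
    by (simp add: sum_distrib_left case_prod_unfold)
  also have "\<dots> = \<epsilon> * (b - a)"
    using additive_tagged_division_1[OF \<open>a \<le> b\<close> p(1), of "\<lambda>x. x"] by simp
  finally have good: "(\<Sum>(x,K)\<in>p - q. f (Sup K) - f (Inf K)) \<le> \<epsilon> * (b - a)" .
  have q_part: "q tagged_partial_division_of {a..b}"
    using tagged_partial_division_subset[OF _ q] p(1) unfolding tagged_division_of_def by simp
  then have q_tag: "q tagged_division_of \<Union>(snd ` q)"
    by (rule tagged_partial_division_of_Union_self)
  then have q_div: "snd ` q division_of \<Union>(snd ` q)" by (rule division_of_tagged_division)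
  have q_sub: "\<Union>(snd ` q) \<subseteq> {a..b}" using q ends by fastforce
  have q_W: "\<Union>(snd ` q) \<subseteq> W" using p(2) unfolding fine_def q_def g_def by fastforce
  have "(\<Sum>K\<in>snd ` q. Sup K - Inf K) = (\<Sum>K\<in>snd ` q. measure lebesgue K)"
  proof (rule sum.cong[OF refl])
    fix K assume "K \<in> snd ` q"
    then obtain s t where "K = {s..t}" "s \<le> t" using q ends by force
    then show "Sup K - Inf K = measure lebesgue K" by simp
  qed
  also have "\<dots> = measure lebesgue (\<Union>(snd ` q))" using content_division[OF q_div] by simp
  also have "\<dots> \<le> measure lebesgue W"
    using q_W W_meas q_div by (intro measure_mono_fmeasurable) (auto simp: fmeasurableD lmeasurable_division)
  finally have "(\<Sum>K\<in>snd ` q. Sup K - Inf K) < \<delta>" using W_small by simp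
  then have "(\<Sum>K\<in>snd ` q. norm (f (Sup K) - f (Inf K))) < \<epsilon>" using \<delta>(2)[OF q_div q_sub] by simp
  \<comment> \<open>Absolute continuity speaks of a set of intervals, the tagged division of pairs.
    An interval carrying two tags must have empty interior, hence is a point and has zero increment,
    so both sums agree.\<close>
  moreover have "(\<Sum>K\<in>snd ` q. norm (f (Sup K) - f (Inf K))) = (\<Sum>(x,K)\<in>q. norm (f (Sup K) - f (Inf K)))"
  proof -
    \<comment> \<open>\<open>Sup {}\<close> and \<open>Inf {}\<close> are unspecified reals.\<close>
    define d where "d K = (if K = {} then 0 else norm (f (Sup K) - f (Inf K)))" for K
    have "d (cbox u v) = 0" if "box u v = {}" for u v
      using that by (cases "u = v") (auto simp: d_def box_eq_empty)
    then have "(\<Sum>(x,K)\<in>q. d K) = (\<Sum>K\<in>snd ` q. d K)"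
      by (rule sum.over_tagged_division_lemma[OF q_tag])
    moreover have "K \<noteq> {}" if "(x, K) \<in> q" for x K using ends q that by force
    then have "(\<Sum>(x,K)\<in>q. d K) = (\<Sum>(x,K)\<in>q. norm (f (Sup K) - f (Inf K)))"
      "(\<Sum>K\<in>snd ` q. d K) = (\<Sum>K\<in>snd ` q. norm (f (Sup K) - f (Inf K)))"
      unfolding d_def by (auto intro!: sum.cong)
    ultimately show ?thesis by simp
  qed
  moreover have "(\<Sum>(x,K)\<in>q. f (Sup K) - f (Inf K)) \<le> (\<Sum>(x,K)\<in>q. norm (f (Sup K) - f (Inf K)))"
    by (intro sum_mono) auto
  moreover have "f b - f a = (\<Sum>(x,K)\<in>q. f (Sup K) - f (Inf K)) + (\<Sum>(x,K)\<in>p - q. f (Sup K) - f (Inf K))"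
    using additive_tagged_division_1[OF \<open>a \<le> b\<close> p(1), of f] 
      sum.subset_diff[OF q fin, of "\<lambda>(x, K). f (Sup K) - f (Inf K)"] by simp
  ultimately show "f b \<le> f a + e" using good \<epsilon>(2) by linarith
qed

text \<open>Testing \<open>f\<close> against its own total increment \<open>w\<close> reduces the
  vector case to scalar monotonicity: by Cauchy-Schwarz the derivative of \<open>h\<close> is
  nonpositive almost everywhere, and the resulting |w|^2 \<le> C (b - a) |w| can be divided by
  |w|.\<close>

lemma abs_continuous_norm_deriv_le:
  fixes f :: "real \<Rightarrow> 'e::euclidean_space"
  assumes ac: "abs_continuous_on_interval a b f" and "a \<le> b" and "negligible N"
    and deriv: "\<And>x. x \<in> {a..b} - N \<Longrightarrow>
      \<exists>D. norm D \<le> C \<and> (f has_vector_derivative D) (at x within {a..b})"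
  shows "norm (f b - f a) \<le> C * (b - a)"
proof -
  define w where "w = f b - f a"
  define h where "h x = f x \<bullet> w - (C * norm w) * x" for x
  have lin: "bounded_linear (\<lambda>y. y \<bullet> w)" by (rule bounded_linear_inner_left)
  have "h b \<le> h a"
  proof (rule abs_continuous_deriv_nonpos_imp_le[OF _ \<open>a \<le> b\<close> \<open>negligible N\<close>])
    have "abs_continuous_on_interval a b (\<lambda>x. (C * norm w) * x)"
      by (rule abs_continuous_on_interval_lipschitz[where L = "\<bar>C * norm w\<bar>"])
         (simp flip: right_diff_distrib abs_mult)
    then show "abs_continuous_on_interval a b h" unfolding h_def
      by (intro abs_continuous_on_interval_diff abs_continuous_on_interval_linear[OF lin ac])
    fix x assume "x \<in> {a..b} - N"
    then obtain D where D: "norm D \<le> C" "(f has_vector_derivative D) (at x within {a..b})"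
      using deriv by blast
    have "D \<bullet> w \<le> C * norm w"
      using norm_cauchy_schwarz[of D w] D(1) by (meson mult_right_mono norm_ge_zero order_trans)
    moreover have "(h has_real_derivative (D \<bullet> w - C * norm w)) (at x within {a..b})"
      unfolding h_def has_real_derivative_iff_has_vector_derivative
      using bounded_linear.has_vector_derivative[OF lin D(2)]
      by (auto intro!: derivative_eq_intros)
    ultimately show "\<exists>D\<le>0. (h has_real_derivative D) (at x within {a..b})"
      by (intro exI[of _ "D \<bullet> w - C * norm w"]) auto
  qed
  then have "w \<bullet> w \<le> norm w * (C * (b - a))"
    unfolding h_def w_def by (simp add: inner_diff algebra_simps)
  then have "norm w * norm w \<le> norm w * (C * (b - a))"
    by (simp add: power2_norm_eq_inner[symmetric] power2_eq_square)
  \<comment> \<open>For w = 0 the sign of \<open>C\<close> is still required. A nondegenerate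
    interval is not negligible, so some point outside \<open>N\<close> provides a derivative whose
    norm is at most \<open>C\<close>.\<close>
  moreover have "0 \<le> C * (b - a)" if "w = 0"
  proof (cases "a = b")
    case False
    then have "a < b" using \<open>a \<le> b\<close> by simp
    then have "\<not> negligible {a..b}" using negligible_interval(1)[of a b] by simp
    then have "\<not> {a..b} \<subseteq> N" using \<open>negligible N\<close> negligible_subset by blast
    then obtain x where "x \<in> {a..b} - N" by blast
    then obtain D :: 'e where "norm D \<le> C" using deriv by blast
    then have "0 \<le> C" using norm_ge_zero order_trans by blast
    then show ?thesis using \<open>a \<le> b\<close> by simp
  qed simp
  ultimately show ?thesis unfolding w_def[symmetric] by (cases "w = 0") auto
qed

section \<open>Block vectors and the indefinite form\<close>

definition vtop :: "complex^('a::finite + 'b::finite) \<Rightarrow> complex^'a" where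
  "vtop y = (\<chi> i. y $ Inl i)"

definition vbot :: "complex^('a::finite + 'b::finite) \<Rightarrow> complex^'b" where
  "vbot y = (\<chi> k. y $ Inr k)"

definition vjoin :: "complex^'a \<Rightarrow> complex^'b \<Rightarrow> complex^('a::finite + 'b::finite)" where
  "vjoin p q = (\<chi> r. case r of Inl i \<Rightarrow> p $ i | Inr k \<Rightarrow> q $ k)"

definition jquad :: "complex^('a::finite + 'b::finite) \<Rightarrow> real" where
  "jquad y = (norm (vtop y))\<^sup>2 - (norm (vbot y))\<^sup>2"

text \<open>The real inner product on complex vectors is only the real part of this form. The order
  on complex numbers in \<open>pos_def\<close> and \<open>pos_semidef\<close> also demands a
  vanishing imaginary part, which is visible only here.\<close>

definition cinner :: "complex^'n \<Rightarrow> complex^'n \<Rightarrow> complex" where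
  "cinner x y = (\<Sum>i\<in>UNIV. cnj (x $ i) * y $ i)"

lemma vtop_vjoin [simp]: "vtop (vjoin p q) = p"
  and vbot_vjoin [simp]: "vbot (vjoin p q) = q"
  by (simp_all add: vtop_def vbot_def vjoin_def vec_eq_iff)

lemma vtop_diff: "vtop (x - y) = vtop x - vtop y"
  and vtop_minus: "vtop (- x) = - vtop x"
  and vbot_minus: "vbot (- x) = - vbot x"
  by (simp_all add: vtop_def vbot_def vec_eq_iff)

lemma vtop_zero [simp]: "vtop 0 = 0" and vbot_zero [simp]: "vbot 0 = 0"
  by (simp_all add: vtop_def vbot_def vec_eq_iff)

lemma eq_vtop_vbotI: "vtop x = vtop y \<Longrightarrow> vbot x = vbot y \<Longrightarrow> x = y"
  unfolding vtop_def vbot_def vec_eq_iff by (metis (no_types) sumE vec_lambda_beta)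

lemma vjoin_vtop_vbot [simp]: "vjoin (vtop y) (vbot y) = y"
  by (rule eq_vtop_vbotI) simp_all

lemma sum_UNIV_sum_type:
  fixes f :: "'a::finite + 'b::finite \<Rightarrow> 'c::comm_monoid_add"
  shows "(\<Sum>r\<in>UNIV. f r) = (\<Sum>i\<in>UNIV. f (Inl i)) + (\<Sum>k\<in>UNIV. f (Inr k))"
  unfolding UNIV_Plus_UNIV[symmetric] by (subst sum.Plus) auto

lemma inner_vtop_vbot:
  fixes x y :: "complex^('a::finite + 'b::finite)"
  shows "x \<bullet> y = vtop x \<bullet> vtop y + vbot x \<bullet> vbot y"
  by (simp add: inner_vec_def sum_UNIV_sum_type vtop_def vbot_def)

lemma norm_vtop_vbot:
  fixes y :: "complex^('a::finite + 'b::finite)"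
  shows "(norm y)\<^sup>2 = (norm (vtop y))\<^sup>2 + (norm (vbot y))\<^sup>2"
  by (simp add: power2_norm_eq_inner inner_vtop_vbot)

lemma vtop_jmat: "vtop (jmat *v y) = vtop y"
  and vbot_jmat: "vbot (jmat *v y) = - vbot y"
  by (simp_all add: vec_eq_iff vtop_def vbot_def jmat_def block_matrix_def block_row_def
      matrix_vector_mult_def sum_UNIV_sum_type mat_def if_distrib[of "\<lambda>x. x * _"] if_distrib[of uminus] sum_negf cong: if_cong)

lemma vtop_Vmat: "vtop (Vmat w *v y) = w *v vbot y"
  and vbot_Vmat: "vbot (Vmat w *v y) = ctranspose w *v vtop y"
  by (simp_all add: vec_eq_iff vtop_def vbot_def Vmat_def block_matrix_def block_row_def
      matrix_vector_mult_def sum_UNIV_sum_type)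

lemma jquad_eq_inner: "jquad y = y \<bullet> (jmat *v y)"
  by (simp add: jquad_def inner_vtop_vbot vtop_jmat vbot_jmat power2_norm_eq_inner)

lemma inner_jmat_commute: "x \<bullet> (jmat *v y) = y \<bullet> (jmat *v x)"
  by (simp add: inner_vtop_vbot vtop_jmat vbot_jmat inner_commute)

section \<open>Hermitian forms and the defining inequalities\<close>

lemma inner_eq_Re_cinner: "x \<bullet> y = Re (cinner x y)"
  by (simp add: inner_vec_def cinner_def inner_complex_def)

lemma cinner_self: "cinner x x = of_real ((norm x)\<^sup>2)"
proof -
  have "Im (cinner x x) = 0" by (simp add: cinner_def Im_sum mult.commute)
  then show ?thesis
    using inner_eq_Re_cinner[of x x] by (simp add: complex_eq_iff power2_norm_eq_inner)
qed

lemma cinner_minus_right: "cinner x (- y) = - cinner x y"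
  by (simp add: cinner_def sum_negf)

lemma cinner_ctranspose: "cinner x (ctranspose A *v y) = cinner (A *v x) y"
  unfolding cinner_def ctranspose_def matrix_vector_mult_def
  by (simp add: sum_distrib_left sum_distrib_right mult_ac cnj_sum) (rule sum.swap)

lemma inner_ctranspose: "x \<bullet> (ctranspose A *v y) = (A *v x) \<bullet> y"
  by (simp add: inner_eq_Re_cinner cinner_ctranspose)

lemma cform_eq_cinner: "cform A f = cinner f (A *v f)"
  by (simp add: cform_def cinner_def matrix_vector_mult_def sum_distrib_left mult_ac)

lemma cform_gram: "cform (ctranspose Q ** Q) f = of_real ((norm (Q *v f))\<^sup>2)"
  by (simp add: cform_eq_cinner cinner_ctranspose cinner_self flip: matrix_vector_mul_assoc)

lemma cinner_vtop_vbot: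
  "cinner x y = cinner (vtop x) (vtop y) + cinner (vbot x) (vbot (y :: complex^('a::finite + 'b::finite)))"
  by (simp add: cinner_def sum_UNIV_sum_type vtop_def vbot_def)

lemma cform_jmat: "cform (ctranspose Q ** jmat ** Q) f = of_real (jquad (Q *v f))"
proof -
  have "cform (ctranspose Q ** jmat ** Q) f = cinner (Q *v f) (jmat *v (Q *v f))"
    by (simp add: cform_eq_cinner cinner_ctranspose flip: matrix_vector_mul_assoc)
  also have "\<dots> = of_real (jquad (Q *v f))"
    by (simp add: cinner_vtop_vbot vtop_jmat vbot_jmat cinner_minus_right cinner_self jquad_def)
  finally show ?thesis .
qed

lemma cform_one_minus_gram:
  "cform (mat 1 - ctranspose Q ** Q) f = of_real ((norm f)\<^sup>2 - (norm (Q *v f))\<^sup>2)"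
proof -
  have "cform (mat 1 - ctranspose Q ** Q) f = cinner f f - cform (ctranspose Q ** Q) f"
    unfolding cform_eq_cinner
    by (simp add: matrix_vector_mult_diff_rdistrib cinner_def algebra_simps sum_subtractf)
  then show ?thesis by (simp add: cform_gram cinner_self)
qed

text \<open>A Gram matrix is positive definite exactly when \<open>Q\<close> is injective. In this
  vector form both inequalities can be compared with \<open>jquad\<close> along solutions.\<close>

lemma P_ineq_iff:
  "P_ineq Q \<longleftrightarrow> (\<forall>f. f \<noteq> 0 \<longrightarrow> Q *v f \<noteq> 0) \<and> (\<forall>f. 0 \<le> jquad (Q *v f))"
  unfolding P_ineq_def pos_def_def pos_semidef_def cform_gram cform_jmat
  by (simp add: less_complex_def less_eq_complex_def)

lemma mat_mult_vector: "mat c *v y = c *s (y :: complex^'n)"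
  by (simp add: vec_eq_iff matrix_vector_mult_def mat_def if_distrib[of "\<lambda>x. x * _"] cong: if_cong)

lemma inner_imaginary_scale: "((\<i> * z) *s y) \<bullet> y = - Im z * (norm y)\<^sup>2"
proof -
  have "((\<i> * z) *s y) \<bullet> y = (\<Sum>i\<in>UNIV. - Im z * (y $ i \<bullet> y $ i))"
    unfolding inner_vec_def by (intro sum.cong) (auto simp: inner_complex_def algebra_simps)
  then show ?thesis by (simp add: sum_distrib_left power2_norm_eq_inner inner_vec_def)
qed

section \<open>Matrix algebra and the symmetry of the coefficient\<close>

lemma bounded_bilinear_matrix_mult:
  "bounded_bilinear (\<lambda>(A :: complex^'n::finite^'m::finite) (B :: complex^'k::finite^'n). A ** B)"
  unfolding bilinear_conv_bounded_bilinear[symmetric] bilinear_def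
  by (auto intro!: linearI simp: vec_eq_iff matrix_matrix_mult_def algebra_simps sum.distrib scaleR_sum_right)

lemma bounded_linear_ctranspose:
  "bounded_linear (ctranspose :: complex^'n::finite^'m::finite \<Rightarrow> complex^'m^'n)"
  unfolding linear_conv_bounded_linear[symmetric]
  by (intro linearI) (simp_all add: vec_eq_iff ctranspose_def)

lemma bounded_linear_matrix_vector_left: "bounded_linear (\<lambda>A :: complex^'n::finite^'m::finite. A *v f)"
  unfolding linear_conv_bounded_linear[symmetric]
  by (intro linearI) (simp_all add: vec_eq_iff matrix_vector_mult_def algebra_simps sum.distrib scaleR_sum_right)

lemma ctranspose_matrix_mult: "ctranspose (A ** B) = ctranspose B ** ctranspose A"
  by (simp add: vec_eq_iff ctranspose_def matrix_matrix_mult_def cnj_sum mult.commute)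

lemma ctranspose_add: "ctranspose (A + B) = ctranspose A + ctranspose B"
  and ctranspose_mat: "ctranspose (mat c) = mat (cnj c)"
  by (simp_all add: vec_eq_iff ctranspose_def mat_def)

lemma ctranspose_jmat: "ctranspose jmat = jmat"
  and ctranspose_Vmat: "ctranspose (Vmat w) = Vmat w"
  by (auto simp: vec_eq_iff ctranspose_def jmat_def Vmat_def block_matrix_def block_row_def mat_def
      split: sum.split)

lemma matrix_vector_mult_minus_right: "A *v (- y) = - (A *v (y :: complex^'n))"
  and matrix_vector_mult_minus_left: "(- A) *v y = - (A *v (y :: complex^'n))"
  by (simp_all add: vec_eq_iff matrix_vector_mult_def sum_negf)

text \<open>An off-diagonal matrix anticommutes with \<open>jmat\<close>. As both factors are
  self-adjoint, \<open>jmat ** Vmat w\<close> is skew-adjoint, which is the symmetry that makes the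
  potential cancel between a solution at \<open>cnj z\<close> and one at \<open>z\<close>.\<close>

lemma Vmat_jmat: "Vmat w ** jmat = - (jmat ** Vmat w)"
proof -
  have "(Vmat w ** jmat) *v y = (- (jmat ** Vmat w)) *v y" for y
  proof -
    have "(Vmat w ** jmat) *v y = - (jmat *v (Vmat w *v y))"
      unfolding matrix_vector_mul_assoc[symmetric]
      by (rule eq_vtop_vbotI)
         (simp_all add: vtop_jmat vbot_jmat vtop_Vmat vbot_Vmat vtop_minus vbot_minus
           matrix_vector_mult_minus_right)
    also have "\<dots> = (- (jmat ** Vmat w)) *v y"
      by (simp add: matrix_vector_mul_assoc matrix_vector_mult_minus_left)
    finally show ?thesis .
  qed
  then show ?thesis by (simp add: matrix_eq)
qed

lemma mat_commute: "mat c ** A = A ** mat (c :: complex)"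
  by (simp add: vec_eq_iff matrix_matrix_mult_def mat_def if_distrib[of "\<lambda>x. x * _"]
      if_distrib[of "\<lambda>x. _ * x"] mult.commute cong: if_cong)

lemma mat_minus: "mat (- c) = - mat (c :: complex)"
  by (simp add: vec_eq_iff mat_def)

lemma matrix_mult_minus_left: "(- A) ** B = - (A ** (B :: complex^'n^'m))"
  and matrix_mult_minus_right: "A ** (- B) = - (A ** (B :: complex^'n^'m))"
  by (simp_all add: vec_eq_iff matrix_matrix_mult_def sum_negf)

section \<open>The fundamental solution\<close>

definition dirac_coeff :: "complex \<Rightarrow> complex^'b^'a \<Rightarrow> complex^('a::finite + 'b::finite)^('a + 'b)" where
  "dirac_coeff z w = mat (\<i> * z) ** jmat + jmat ** Vmat w"

lemma ctranspose_dirac_coeff: "ctranspose (dirac_coeff (cnj z) w) = - dirac_coeff z w"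
  by (simp add: dirac_coeff_def ctranspose_add ctranspose_matrix_mult ctranspose_mat ctranspose_jmat
      ctranspose_Vmat Vmat_jmat mat_minus matrix_mult_minus_left matrix_mult_minus_right mat_commute)

lemma dirac_coeff_diff:
  fixes w :: "complex^'b::finite^'a::finite"
  shows "dirac_coeff z w - dirac_coeff z0 w = mat (\<i> * (z - z0)) ** jmat"
proof -
  have "mat (\<i> * z) - mat (\<i> * z0) = (mat (\<i> * (z - z0)) :: complex^('a + 'b)^('a + 'b))"
    by (simp add: vec_eq_iff mat_def algebra_simps)
  then show ?thesis
    by (simp add: dirac_coeff_def flip: bounded_bilinear.diff_left[OF bounded_bilinear_matrix_mult])
qed

text \<open>The left side is half the derivative of \<open>jquad\<close> along a solution. The
  spectral term gives - Im z |y|^2, since \<open>jmat\<close> is isometric; the potential gives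
  twice the real part of p^* w q, at most 2 M |p| |q|, and M (|p| - |q|)^2 \<ge> 0 turns this into M
  |y|^2.\<close>

lemma inner_dirac_coeff_le:
  assumes "\<And>f. norm (w *v f) \<le> M * norm f"
  shows "(dirac_coeff z w *v y) \<bullet> (jmat *v y) \<le> - (Im z - M) * (norm y)\<^sup>2"
proof -
  let ?p = "vtop y" and ?q = "vbot y"
  have "dirac_coeff z w *v y = (\<i> * z) *s (jmat *v y) + jmat *v (Vmat w *v y)"
    by (simp add: dirac_coeff_def matrix_vector_mult_add_rdistrib mat_mult_vector flip: matrix_vector_mul_assoc)
  then have "(dirac_coeff z w *v y) \<bullet> (jmat *v y) =
      - Im z * (norm (jmat *v y))\<^sup>2 + (jmat *v (Vmat w *v y)) \<bullet> (jmat *v y)"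
    by (simp only: inner_add_left inner_imaginary_scale)
  also have "(norm (jmat *v y))\<^sup>2 = (norm y)\<^sup>2"
    by (simp add: norm_vtop_vbot vtop_jmat vbot_jmat)
  also have "(jmat *v (Vmat w *v y)) \<bullet> (jmat *v y) = 2 * ((w *v ?q) \<bullet> ?p)"
    by (simp add: inner_vtop_vbot vtop_jmat vbot_jmat vtop_Vmat vbot_Vmat inner_commute inner_ctranspose
        matrix_vector_mult_minus_right)
  also have "(w *v ?q) \<bullet> ?p \<le> norm (w *v ?q) * norm ?p" by (rule norm_cauchy_schwarz)
  also have "\<dots> \<le> (M * norm ?q) * norm ?p" using assms by (intro mult_right_mono) auto
  finally have 1: "(dirac_coeff z w *v y) \<bullet> (jmat *v y) \<le> - Im z * (norm y)\<^sup>2 + 2 * (M * norm ?q * norm ?p)"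
    by simp
  have "M * (norm y)\<^sup>2 - 2 * (M * norm ?q * norm ?p) = M * (norm ?p - norm ?q)\<^sup>2"
    by (simp add: norm_vtop_vbot power2_diff algebra_simps)
  also have "\<dots> \<ge> 0"
  proof (cases "M \<ge> 0")
    \<comment> \<open>A negative \<open>M\<close> contradicts the bound on \<open>w\<close>, as
      every vector would have to vanish, including the unit vectors.\<close>
    case False
    have "norm (w *v f) < 0" if "f \<noteq> 0" for f
    proof -
      have "M * norm f < 0" using that False by (intro mult_neg_pos) auto
      then show ?thesis using assms[of f] by linarith
    qed
    then have "f = 0" for f using norm_ge_zero not_le by blast
    then show ?thesis by (metis axis_eq_0_iff zero_neq_one)
  qed simp
  finally show ?thesis using 1 by (simp add: algebra_simps)
qed

lemma AE_lebesgue_on_negligibleE: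
  assumes "AE x in lebesgue_on S. P x" "S \<in> sets lebesgue"
  obtains N where "negligible N" "\<And>x. x \<in> S - N \<Longrightarrow> P x"
proof -
  obtain N where N: "{x \<in> space (lebesgue_on S). \<not> P x} \<subseteq> N" "emeasure (lebesgue_on S) N = 0" "N \<in> sets (lebesgue_on S)"
    using assms(1) by (rule AE_E)
  then have "N \<in> null_sets (lebesgue_on S)" by (simp add: null_setsI)
  then have "negligible N" using assms(2) by (simp add: null_sets_restrict_space negligible_iff_null_sets)
  with N(1) show ?thesis using that by auto
qed

lemma has_field_derivative_quadratic_error:
  fixes f :: "complex \<Rightarrow> complex"
  assumes "\<delta> > 0" "C \<ge> 0"
    and "\<And>z. norm (z - z0) < \<delta> \<Longrightarrow> norm (f z - f z0 - D * (z - z0)) \<le> C * (norm (z - z0))\<^sup>2"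
  shows "(f has_field_derivative D) (at z0)"
  unfolding has_field_derivative_def has_derivative_at_alt
proof (intro conjI allI impI bounded_linear_mult_right)
  fix e :: real assume "e > 0"
  have "norm (f z - f z0 - D * (z - z0)) \<le> e * norm (z - z0)"
    if z: "norm (z - z0) < min \<delta> (e / (C + 1))" for z
  proof -
    have "C * norm (z - z0) \<le> C * (e / (C + 1))" using z \<open>C \<ge> 0\<close> by (intro mult_left_mono) auto
    also have "\<dots> \<le> e" using \<open>C \<ge> 0\<close> \<open>e > 0\<close> by (simp add: field_simps)
    finally have "C * norm (z - z0) * norm (z - z0) \<le> e * norm (z - z0)" by (intro mult_right_mono) auto
    with assms(3)[of z] z show ?thesis by (simp add: power2_eq_square)
  qed
  moreover have "min \<delta> (e / (C + 1)) > 0" using assms \<open>e > 0\<close> by simp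
  ultimately show "\<exists>d>0. \<forall>y. norm (y - z0) < d \<longrightarrow> norm (f y - f z0 - D * (y - z0)) \<le> e * norm (y - z0)"
    by blast
qed

section \<open>Solutions and their dependence on the spectral parameter\<close>

locale dirac_system =
  fixes M :: real
    and v :: "real \<Rightarrow> complex^'b::finite^'a::finite"
    and u :: "real \<Rightarrow> complex \<Rightarrow> complex^('a + 'b)^('a + 'b)"
  assumes onorm_v: "\<And>x. x \<ge> 0 \<Longrightarrow> onorm (\<lambda>f. v x *v f) \<le> M"
    and solution: "fundamental_solution v u"
begin

lemma norm_v_le: "x \<ge> 0 \<Longrightarrow> norm (v x *v f) \<le> M * norm f"
  using onorm[OF matrix_vector_mul_bounded_linear, of "v x" f] onorm_v[of x]
  by (meson mult_right_mono norm_ge_zero order_trans)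

lemma u_zero: "u 0 z = mat 1"
  and u_abs_continuous: "b \<ge> 0 \<Longrightarrow> abs_continuous_on_interval 0 b (\<lambda>x. u x z)"
  using solution unfolding fundamental_solution_def by blast+

text \<open>The null set depends on \<open>z\<close> but not on the right endpoint \<open>b\<close>.
  Hence each estimate below compares solutions at one or two spectral parameters only, and nothing
  is differentiated in \<open>z\<close> under the almost everywhere quantifier.\<close>

lemma u_deriv:
  obtains N where "negligible N" "\<And>x b. x \<in> {0..b} - N \<Longrightarrow>
    ((\<lambda>x. u x z) has_vector_derivative dirac_coeff z (v x) ** u x z) (at x within {0..b})"
proof -
  have "AE x in lebesgue_on {0..}.
      ((\<lambda>x. u x z) has_vector_derivative dirac_coeff z (v x) ** u x z) (at x within {0..})"
    using solution unfolding fundamental_solution_def dirac_coeff_def by blast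
  then obtain N where "negligible N" "\<And>x. x \<in> {0..} - N \<Longrightarrow>
      ((\<lambda>x. u x z) has_vector_derivative dirac_coeff z (v x) ** u x z) (at x within {0..})"
    by (rule AE_lebesgue_on_negligibleE) auto
  note N = this
  show ?thesis
  proof (rule that[OF N(1)])
    fix x b assume "x \<in> {0..b} - N"
    then show "((\<lambda>x. u x z) has_vector_derivative dirac_coeff z (v x) ** u x z) (at x within {0..b})"
      by (intro has_vector_derivative_within_subset[OF N(2)]) auto
  qed
qed

text \<open>This is u(x,z0)^{-1} u(x,z), the unknown of variation of constants. With the adjoint in
  place of the inverse it is a product of absolutely continuous functions from the outset, and the
  invertibility of \<open>u\<close> becomes a consequence.\<close>

definition transition :: "complex \<Rightarrow> complex \<Rightarrow> real \<Rightarrow> complex^('a + 'b)^('a + 'b)" where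
  "transition z0 z x = ctranspose (u x (cnj z0)) ** u x z"

lemma transition_abs_continuous: "b \<ge> 0 \<Longrightarrow> abs_continuous_on_interval 0 b (transition z0 z)"
  unfolding transition_def
  by (intro abs_continuous_on_interval_bilinear[OF bounded_bilinear_matrix_mult]
      abs_continuous_on_interval_linear[OF bounded_linear_ctranspose] u_abs_continuous)

text \<open>In the product rule the adjoint of the coefficient at \<open>cnj z0\<close> is minus the
  coefficient at \<open>z0\<close>. The difference of the coefficients at \<open>z\<close> and
  \<open>z0\<close> no longer contains the potential.\<close>

lemma transition_deriv:
  obtains N where "negligible N" "\<And>x b. x \<in> {0..b} - N \<Longrightarrow>
    (transition z0 z has_vector_derivative
      mat (\<i> * (z - z0)) ** (ctranspose (u x (cnj z0)) ** jmat ** u x z)) (at x within {0..b})"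
proof -
  obtain N1 where N1: "negligible N1" "\<And>x b. x \<in> {0..b} - N1 \<Longrightarrow>
    ((\<lambda>x. u x z) has_vector_derivative dirac_coeff z (v x) ** u x z) (at x within {0..b})"
    by (rule u_deriv[of z]) blast
  obtain N2 where N2: "negligible N2" "\<And>x b. x \<in> {0..b} - N2 \<Longrightarrow>
    ((\<lambda>x. u x (cnj z0)) has_vector_derivative dirac_coeff (cnj z0) (v x) ** u x (cnj z0)) (at x within {0..b})"
    by (rule u_deriv[of "cnj z0"]) blast
  show ?thesis
  proof (rule that[of "N1 \<union> N2"])
    show "negligible (N1 \<union> N2)" using N1 N2 by simp
    fix x b assume x: "x \<in> {0..b} - (N1 \<union> N2)"
    let ?U = "ctranspose (u x (cnj z0))"
    have "(transition z0 z has_vector_derivative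
        ?U ** (dirac_coeff z (v x) ** u x z) + ctranspose (dirac_coeff (cnj z0) (v x) ** u x (cnj z0)) ** u x z)
        (at x within {0..b})"
      unfolding transition_def using x
      by (intro bounded_bilinear.has_vector_derivative[OF bounded_bilinear_matrix_mult]
          bounded_linear.has_vector_derivative[OF bounded_linear_ctranspose] N1 N2) auto
    also have "?U ** (dirac_coeff z (v x) ** u x z) + ctranspose (dirac_coeff (cnj z0) (v x) ** u x (cnj z0)) ** u x z
        = ?U ** (dirac_coeff z (v x) - dirac_coeff z0 (v x)) ** u x z"
      by (simp add: ctranspose_matrix_mult ctranspose_dirac_coeff matrix_mult_minus_right matrix_mult_minus_left
          matrix_mul_assoc bounded_bilinear.diff_left[OF bounded_bilinear_matrix_mult]
          bounded_bilinear.diff_right[OF bounded_bilinear_matrix_mult])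
    also have "\<dots> = mat (\<i> * (z - z0)) ** (?U ** jmat ** u x z)"
      by (simp add: dirac_coeff_diff matrix_mul_assoc mat_commute[of _ ?U])
    finally show "(transition z0 z has_vector_derivative
      mat (\<i> * (z - z0)) ** (?U ** jmat ** u x z)) (at x within {0..b})" .
  qed
qed

text \<open>For z = z0 the transition matrix has derivative zero almost everywhere; being absolutely
  continuous it keeps its initial value.\<close>

lemma adjoint_inverse_left:
  assumes "x \<ge> 0" shows "ctranspose (u x (cnj z)) ** u x z = mat 1"
proof -
  obtain N where N: "negligible N" "\<And>x b. x \<in> {0..b} - N \<Longrightarrow>
    (transition z z has_vector_derivative
      mat (\<i> * (z - z)) ** (ctranspose (u x (cnj z)) ** jmat ** u x z)) (at x within {0..b})"
    by (rule transition_deriv[of z z]) blast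
  have "norm (transition z z x - transition z z 0) \<le> 0 * (x - 0)"
    using N(2) assms
    by (intro abs_continuous_norm_deriv_le[OF transition_abs_continuous _ N(1)] exI[of _ 0] conjI) auto
  then show ?thesis
    by (simp add: transition_def u_zero ctranspose_mat)
qed

lemma adjoint_inverse_right:
  assumes "x \<ge> 0" shows "u x z ** ctranspose (u x (cnj z)) = mat 1"
  using adjoint_inverse_left[OF assms] matrix_left_right_inverse by blast

lemma invertible_u: "x \<ge> 0 \<Longrightarrow> invertible (u x z)"
  using adjoint_inverse_left adjoint_inverse_right unfolding invertible_def by blast

lemma u_eq_transition:
  assumes "x \<ge> 0" shows "u x z = u x z0 ** transition z0 z x"
  unfolding transition_def matrix_mul_assoc by (simp add: adjoint_inverse_right assms)

text \<open>One step of Picard iteration: T = \<open>transition z0 z\<close> solves T' = i (z - z0)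
  K T, T(0) = 1, where K = u^{-1} j u at z0 does not depend on z. Thus T - 1 is of order |z - z0|,
  and replacing T by 1 on the right side, which makes \<open>G\<close> the primitive of
  \<open>K\<close>, costs only a second order error.\<close>

lemma transition_expansion:
  assumes "b \<ge> 0"
  obtains G C \<delta> where "\<delta> > 0" "C \<ge> 0"
    "\<And>z. norm (z - z0) < \<delta> \<Longrightarrow>
      norm (transition z0 z b - mat 1 - mat (\<i> * (z - z0)) ** G) \<le> C * (norm (z - z0))\<^sup>2"
proof -
  define K where "K x = ctranspose (u x (cnj z0)) ** jmat ** u x z0" for x
  note bb = bounded_bilinear_matrix_mult
  have K_ac: "abs_continuous_on_interval 0 b K" unfolding K_def
    by (intro abs_continuous_on_interval_bilinear[OF bb] abs_continuous_on_interval_const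
      abs_continuous_on_interval_linear[OF bounded_linear_ctranspose] u_abs_continuous assms)
  have K_cont: "continuous_on {0..b} K" by (rule abs_continuous_on_interval_imp_continuous_on[OF K_ac])
  obtain k where k: "k > 0" "\<And>x. x \<in> {0..b} \<Longrightarrow> norm (K x) \<le> k"
    by (rule abs_continuous_on_interval_bounded[OF K_ac]) blast
  define G where "G x = integral {0..x} K" for x
  have G_deriv: "(G has_vector_derivative K x) (at x within {0..b})" if "x \<in> {0..b}" for x
    unfolding G_def using integral_has_vector_derivative[OF K_cont that] .
  have "norm (G t - G s) \<le> k * norm (t - s)" if "s \<in> {0..b}" "t \<in> {0..b}" for s t
    using G_deriv k that unfolding has_vector_derivative_def
    by (intro differentiable_bound[of "{0..b}" G "\<lambda>x h. h *\<^sub>R K x"] onorm_bound)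
       (auto simp: mult.commute[of k] intro: mult_left_mono)
  then have G_ac: "abs_continuous_on_interval 0 b G"
    by (intro abs_continuous_on_interval_lipschitz[where L = k]) auto
  obtain B where B: "B > 0" "\<And>(X :: complex^('a + 'b)^('a + 'b)) (Y :: complex^('a + 'b)^('a + 'b)). norm (X ** Y) \<le> norm X * norm Y * B"
    using bounded_bilinear.pos_bounded[OF bb] by blast
  have "bounded_linear (mat :: complex \<Rightarrow> complex^('a + 'b)^('a + 'b))"
    unfolding linear_conv_bounded_linear[symmetric] by (intro linearI) (simp_all add: vec_eq_iff mat_def)
  then obtain A where A: "A > 0" "\<And>c. norm (mat c :: complex^('a + 'b)^('a + 'b)) \<le> norm c * A"
    using bounded_linear.pos_bounded by blast
  \<comment> \<open>\<open>q\<close> bounds the effect of the right side over the whole interval.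
    The matrix norm here is the Frobenius norm, so the identity has a norm \<open>e\<close>
    different from 1.\<close>
  define q where "q = A * (k * B) * B * b"
  define e where "e = norm (mat 1 :: complex^('a + 'b)^('a + 'b))"
  have "q \<ge> 0" using A B k assms by (simp add: q_def)
  have bound: "norm (mat (\<i> * (z - z0)) ** (K x ** Y)) * b \<le> q * norm (z - z0) * norm Y"
    if "x \<in> {0..b}" for x z and Y :: "complex^('a + 'b)^('a + 'b)"
  proof -
    have "norm (mat (\<i> * (z - z0)) ** (K x ** Y)) \<le> (norm (z - z0) * A) * (k * norm Y * B) * B"
    proof -
      have "norm (mat (\<i> * (z - z0)) :: complex^('a + 'b)^('a + 'b)) \<le> norm (z - z0) * A"
        using A(2)[of "\<i> * (z - z0)"] by (simp add: norm_mult)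
      moreover have "norm (K x ** Y) \<le> k * norm Y * B"
        using B(2)[of "K x" Y] k(2)[OF that] B(1)
        by (meson mult_right_mono norm_ge_zero order_trans less_imp_le)
      ultimately have "norm (mat (\<i> * (z - z0)) :: complex^('a + 'b)^('a + 'b)) * norm (K x ** Y) * B
          \<le> (norm (z - z0) * A) * (k * norm Y * B) * B"
        using A(1) B(1) by (intro mult_right_mono mult_mono) auto
      then show ?thesis using B(2) order_trans by blast
    qed
    then have "norm (mat (\<i> * (z - z0)) ** (K x ** Y)) * b \<le> (norm (z - z0) * A) * (k * norm Y * B) * B * b"
      using assms by (intro mult_right_mono) auto
    then show ?thesis by (simp add: q_def mult_ac)
  qed
  \<comment> \<open>Chosen so that q |z - z0| \<le> 1/2, which allows \<tau> to be absorbed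
    below.\<close>
  define \<delta> where "\<delta> = 1 / (2 * (q + 1))"
  have "\<delta> > 0" using \<open>q \<ge> 0\<close> by (simp add: \<delta>_def)
  have main: "norm (transition z0 z b - mat 1 - mat (\<i> * (z - z0)) ** G b) \<le> 2 * q\<^sup>2 * e * (norm (z - z0))\<^sup>2"
    if z: "norm (z - z0) < \<delta>" for z
  proof (cases "b = 0")
    case True
    then have "transition z0 z b = mat 1" "G b = 0" by (simp_all add: transition_def u_zero ctranspose_mat G_def)
    then show ?thesis using \<open>q \<ge> 0\<close> by (simp add: e_def)
  next
    case False
    then have "b > 0" using assms by simp
    let ?T = "transition z0 z" and ?c = "mat (\<i> * (z - z0)) :: complex^('a + 'b)^('a + 'b)"
    define \<epsilon> where "\<epsilon> = norm (z - z0)"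
    have small: "q * \<epsilon> \<le> 1 / 2"
    proof -
      have "q * \<epsilon> \<le> q * \<delta>" using z \<open>q \<ge> 0\<close> by (intro mult_left_mono) (auto simp: \<epsilon>_def)
      also have "\<dots> \<le> 1 / 2" using \<open>q \<ge> 0\<close> by (simp add: \<delta>_def field_simps)
      finally show ?thesis .
    qed
    obtain N where N: "negligible N" "\<And>x b. x \<in> {0..b} - N \<Longrightarrow>
      (transition z0 z has_vector_derivative ?c ** (ctranspose (u x (cnj z0)) ** jmat ** u x z)) (at x within {0..b})"
      by (rule transition_deriv[of z0 z]) blast
    have T_deriv: "(?T has_vector_derivative ?c ** (K x ** ?T x)) (at x within {0..d})" if "x \<in> {0..d} - N" for x d
      using N(2)[OF that] u_eq_transition[of x z z0] that by (simp add: K_def matrix_mul_assoc)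
    have T_zero: "?T 0 = mat 1" by (simp add: transition_def u_zero ctranspose_mat)
    have T_ac: "abs_continuous_on_interval 0 d ?T" if "d \<ge> 0" for d
      using transition_abs_continuous that by blast
    \<comment> \<open>A substitute for Gronwall's inequality: integrating only up to a maximum point
      \<xi> of |T - 1| gives \<tau> \<le> q \<epsilon> (e + \<tau>), and since q \<epsilon> \<le>
      1/2 this can be solved for \<tau>.\<close>
    have "continuous_on {0..b} (\<lambda>x. norm (?T x - mat 1))"
      by (intro continuous_intros abs_continuous_on_interval_imp_continuous_on T_ac assms)
    then obtain \<xi> where \<xi>: "\<xi> \<in> {0..b}" "\<And>x. x \<in> {0..b} \<Longrightarrow> norm (?T x - mat 1) \<le> norm (?T \<xi> - mat 1)"
      using continuous_attains_sup[of "{0..b}" "\<lambda>x. norm (?T x - mat 1)"] assms by auto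
    define \<tau> where "\<tau> = norm (?T \<xi> - mat 1)"
    have "\<tau> \<ge> 0" by (simp add: \<tau>_def)
    have "norm (?T \<xi> - ?T 0) \<le> (q * \<epsilon> * (e + \<tau>) / b) * (\<xi> - 0)"
    proof (rule abs_continuous_norm_deriv_le[OF T_ac _ N(1)])
      fix x assume x: "x \<in> {0..\<xi>} - N"
      then have xb: "x \<in> {0..b}" using \<xi>(1) by auto
      have "norm (?T x) \<le> e + \<tau>"
        using \<xi>(2)[OF xb] norm_triangle_ineq[of "?T x - mat 1" "mat 1"] by (simp add: e_def \<tau>_def)
      then have "q * \<epsilon> * norm (?T x) \<le> q * \<epsilon> * (e + \<tau>)"
        using \<open>q \<ge> 0\<close> by (intro mult_left_mono) (auto simp: \<epsilon>_def)
      with bound[OF xb, of z "?T x"] have "norm (?c ** (K x ** ?T x)) * b \<le> q * \<epsilon> * (e + \<tau>)"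
        by (simp add: \<epsilon>_def)
      then show "\<exists>D. norm D \<le> q * \<epsilon> * (e + \<tau>) / b \<and> (?T has_vector_derivative D) (at x within {0..\<xi>})"
        using T_deriv[OF x] \<open>b > 0\<close> by (auto simp: pos_le_divide_eq)
    qed (use \<xi>(1) in auto)
    also have "\<dots> \<le> (q * \<epsilon> * (e + \<tau>) / b) * b"
      using \<xi>(1) \<open>q \<ge> 0\<close> \<open>\<tau> \<ge> 0\<close> \<open>b > 0\<close> by (intro mult_left_mono) (auto simp: \<epsilon>_def e_def)
    also have "\<dots> = q * \<epsilon> * e + q * \<epsilon> * \<tau>" using \<open>b > 0\<close> by (simp add: distrib_left)
    also have "\<dots> \<le> q * \<epsilon> * e + (1 / 2) * \<tau>"
      using small \<open>\<tau> \<ge> 0\<close> by (intro add_left_mono mult_right_mono)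
    finally have \<tau>: "\<tau> \<le> 2 * (q * \<epsilon> * e)" by (simp add: T_zero \<tau>_def)
    \<comment> \<open>The derivative of the remainder is ?c K (T - 1), where both \<open>?c\<close>
      and T - 1 are of first order in \<epsilon>.\<close>
    define R where "R x = ?T x - mat 1 - ?c ** G x" for x
    have "norm (R b - R 0) \<le> (q * \<epsilon> * \<tau> / b) * (b - 0)"
    proof (rule abs_continuous_norm_deriv_le[OF _ assms N(1)])
      show "abs_continuous_on_interval 0 b R" unfolding R_def
        by (intro abs_continuous_on_interval_diff T_ac assms abs_continuous_on_interval_const
            abs_continuous_on_interval_bilinear[OF bb] G_ac)
      fix x assume x: "x \<in> {0..b} - N"
      then have xb: "x \<in> {0..b}" by simp
      have "(R has_vector_derivative ?c ** (K x ** ?T x) - 0 - ?c ** K x) (at x within {0..b})"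
        unfolding R_def
        by (intro has_vector_derivative_diff T_deriv[OF x] has_vector_derivative_const
            bounded_linear.has_vector_derivative[OF bounded_bilinear.bounded_linear_right[OF bb]] G_deriv[OF xb])
      also have "?c ** (K x ** ?T x) - 0 - ?c ** K x = ?c ** (K x ** (?T x - mat 1))"
        by (simp add: bounded_bilinear.diff_right[OF bb])
      finally have "(R has_vector_derivative ?c ** (K x ** (?T x - mat 1))) (at x within {0..b})" .
      moreover have "q * \<epsilon> * norm (?T x - mat 1) \<le> q * \<epsilon> * \<tau>"
        using \<xi>(2)[OF xb] \<open>q \<ge> 0\<close> by (intro mult_left_mono) (auto simp: \<epsilon>_def \<tau>_def)
      with bound[OF xb, of z "?T x - mat 1"] have "norm (?c ** (K x ** (?T x - mat 1))) * b \<le> q * \<epsilon> * \<tau>"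
        by (simp add: \<epsilon>_def)
      ultimately show "\<exists>D. norm D \<le> q * \<epsilon> * \<tau> / b \<and> (R has_vector_derivative D) (at x within {0..b})"
        using \<open>b > 0\<close> by (auto simp: pos_le_divide_eq)
    qed
    also have "\<dots> = q * \<epsilon> * \<tau>" using \<open>b > 0\<close> by simp
    also have "\<dots> \<le> q * \<epsilon> * (2 * (q * \<epsilon> * e))"
      using \<tau> \<open>q \<ge> 0\<close> by (intro mult_left_mono) (auto simp: \<epsilon>_def)
    finally show ?thesis
      by (simp add: R_def T_zero G_def \<epsilon>_def power2_eq_square mult_ac bounded_bilinear.zero_right[OF bb])
  qed
  show ?thesis by (rule that[OF \<open>\<delta> > 0\<close> _ main]) (simp_all add: e_def)
qed

text \<open>In u(b,z) = u(b,z0) T(z) the first factor is constant in z, so the expansion of the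
  transition matrix gives complex differentiability at z0.\<close>

lemma u_holomorphic:
  assumes "b \<ge> 0" shows "(\<lambda>z. u b z $ r $ s) holomorphic_on A"
proof -
  have "(\<lambda>z. u b z $ r $ s) field_differentiable (at z0)" for z0
  proof -
    obtain G C \<delta> where G: "\<delta> > 0" "C \<ge> 0"
      "\<And>z. norm (z - z0) < \<delta> \<Longrightarrow>
        norm (transition z0 z b - mat 1 - mat (\<i> * (z - z0)) ** G) \<le> C * (norm (z - z0))\<^sup>2"
      by (rule transition_expansion[OF assms, of z0]) blast
    have "((\<lambda>z. transition z0 z b $ l $ s) has_field_derivative \<i> * G $ l $ s) (at z0)" for l
    proof (rule has_field_derivative_quadratic_error[OF G(1,2)])
      fix z assume z: "norm (z - z0) < \<delta>"
      have "transition z0 z0 b = mat 1"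
        using adjoint_inverse_left[OF assms] by (simp add: transition_def)
      then have "transition z0 z b $ l $ s - transition z0 z0 b $ l $ s - \<i> * G $ l $ s * (z - z0) =
          (transition z0 z b - mat 1 - mat (\<i> * (z - z0)) ** G) $ l $ s"
        by (simp add: matrix_matrix_mult_def mat_def if_distrib[of "\<lambda>x. x * _"] cong: if_cong)
      also have "norm \<dots> \<le> norm (transition z0 z b - mat 1 - mat (\<i> * (z - z0)) ** G)"
        by (meson Finite_Cartesian_Product.norm_nth_le order_trans)
      also have "\<dots> \<le> C * (norm (z - z0))\<^sup>2" by (rule G(3)[OF z])
      finally show "norm (transition z0 z b $ l $ s - transition z0 z0 b $ l $ s - \<i> * G $ l $ s * (z - z0))
        \<le> C * (norm (z - z0))\<^sup>2" .
    qed
    then have "(\<lambda>z. transition z0 z b $ l $ s) field_differentiable (at z0)" for l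
      using field_differentiable_def by blast
    moreover have "(\<lambda>z. u b z $ r $ s) = (\<lambda>z. \<Sum>l\<in>UNIV. u b z0 $ r $ l * transition z0 z b $ l $ s)"
      by (rule ext) (subst u_eq_transition[OF assms, of _ z0], simp add: matrix_matrix_mult_def)
    ultimately show ?thesis
      by (auto intro!: derivative_intros)
  qed
  then show ?thesis by (intro holomorphic_onI) (rule field_differentiable_at_within)
qed

section \<open>Monotonicity of the indefinite form along solutions\<close>

lemma jquad_abs_continuous:
  assumes "b \<ge> 0" shows "abs_continuous_on_interval 0 b (\<lambda>x. jquad (u x z *v f))"
  unfolding jquad_eq_inner
  by (intro abs_continuous_on_interval_bilinear[OF bounded_bilinear_inner]
      abs_continuous_on_interval_linear[OF matrix_vector_mul_bounded_linear]
      abs_continuous_on_interval_linear[OF bounded_linear_matrix_vector_left] u_abs_continuous assms)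

lemma jquad_deriv:
  obtains N where "negligible N" "\<And>x b. x \<in> {0..b} - N \<Longrightarrow>
    \<exists>D \<le> - 2 * (Im z - M) * (norm (u x z *v f))\<^sup>2.
      ((\<lambda>x. jquad (u x z *v f)) has_real_derivative D) (at x within {0..b})"
proof -
  obtain N where N: "negligible N" "\<And>x b. x \<in> {0..b} - N \<Longrightarrow>
    ((\<lambda>x. u x z) has_vector_derivative dirac_coeff z (v x) ** u x z) (at x within {0..b})"
    by (rule u_deriv[of z]) blast
  show ?thesis
  proof (rule that[OF N(1)])
    fix x b assume x: "x \<in> {0..b} - N"
    let ?y = "u x z *v f" and ?D = "dirac_coeff z (v x) *v (u x z *v f)"
    have y: "((\<lambda>x. u x z *v f) has_vector_derivative ?D) (at x within {0..b})"
      using bounded_linear.has_vector_derivative[OF bounded_linear_matrix_vector_left N(2)[OF x], of f]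
      by (simp add: matrix_vector_mul_assoc)
    have "((\<lambda>x. jquad (u x z *v f)) has_vector_derivative ?y \<bullet> (jmat *v ?D) + ?D \<bullet> (jmat *v ?y)) (at x within {0..b})"
      unfolding jquad_eq_inner
      by (intro bounded_bilinear.has_vector_derivative[OF bounded_bilinear_inner]
          bounded_linear.has_vector_derivative[OF matrix_vector_mul_bounded_linear] y)
    moreover have "?y \<bullet> (jmat *v ?D) + ?D \<bullet> (jmat *v ?y) = 2 * (?D \<bullet> (jmat *v ?y))"
      using inner_jmat_commute[of ?y ?D] by simp
    moreover have "?D \<bullet> (jmat *v ?y) \<le> - (Im z - M) * (norm ?y)\<^sup>2"
      using x by (intro inner_dirac_coeff_le norm_v_le) auto
    then have "2 * (?D \<bullet> (jmat *v ?y)) \<le> - 2 * (Im z - M) * (norm ?y)\<^sup>2"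
      by (simp add: algebra_simps)
    ultimately show "\<exists>D \<le> - 2 * (Im z - M) * (norm (u x z *v f))\<^sup>2.
      ((\<lambda>x. jquad (u x z *v f)) has_real_derivative D) (at x within {0..b})"
      unfolding has_real_derivative_iff_has_vector_derivative
      by (intro exI[of _ "2 * (?D \<bullet> (jmat *v ?y))"]) auto
  qed
qed

lemma jquad_antimono:
  assumes "0 \<le> s" "s \<le> t" "M \<le> Im z"
  shows "jquad (u t z *v f) \<le> jquad (u s z *v f)"
proof -
  obtain N where N: "negligible N" "\<And>x b. x \<in> {0..b} - N \<Longrightarrow>
    \<exists>D \<le> - 2 * (Im z - M) * (norm (u x z *v f))\<^sup>2.
      ((\<lambda>x. jquad (u x z *v f)) has_real_derivative D) (at x within {0..b})"
    by (rule jquad_deriv[of z f]) blast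
  show ?thesis
  proof (rule abs_continuous_deriv_nonpos_imp_le[OF _ assms(2) N(1)])
    show "abs_continuous_on_interval s t (\<lambda>x. jquad (u x z *v f))"
      using abs_continuous_on_interval_subset[OF jquad_abs_continuous[of t z f]] assms by simp
    fix x assume x: "x \<in> {s..t} - N"
    then obtain D where D: "D \<le> - 2 * (Im z - M) * (norm (u x z *v f))\<^sup>2"
      "((\<lambda>x. jquad (u x z *v f)) has_real_derivative D) (at x within {0..t})"
      using N(2)[of x t] assms by auto
    have "0 \<le> (Im z - M) * (norm (u x z *v f))\<^sup>2" using assms by simp
    with D(1) have "D \<le> 0" by linarith
    moreover have "((\<lambda>x. jquad (u x z *v f)) has_real_derivative D) (at x within {s..t})"
      using D(2) by (rule DERIV_subset) (use assms in auto)
    ultimately show "\<exists>D\<le>0. ((\<lambda>x. jquad (u x z *v f)) has_real_derivative D) (at x within {s..t})" by blast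
  qed
qed

lemma jquad_u_le: "0 \<le> x \<Longrightarrow> M \<le> Im z \<Longrightarrow> jquad (u x z *v f) \<le> jquad f"
  using jquad_antimono[of 0 x z f] by (simp add: u_zero)

text \<open>
  Along a solution that stays \<open>j\<close>-nonnegative, \<open>\<parallel>y\<parallel>\<^sup>2\<close> is integrable, whereas \<open>\<parallel>y\<parallel>\<close> is bounded
  below along a solution that starts \<open>j\<close>-negative. The difference of \<open>f\<close> and \<open>g\<close> would give both.
\<close>

lemma jquad_nonneg_unique:
  assumes "M < Im z" and "vtop f = vtop g"
    and f: "\<And>x. x \<ge> 0 \<Longrightarrow> 0 \<le> jquad (u x z *v f)"
    and g: "\<And>x. x \<ge> 0 \<Longrightarrow> 0 \<le> jquad (u x z *v g)"
  shows "f = g"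
proof -
  define h where "h = f - g"
  define c where "c = Im z - M"
  have "c > 0" using assms by (simp add: c_def)
  have jh: "jquad h = - (norm h)\<^sup>2"
    using assms(2) by (simp add: jquad_def norm_vtop_vbot h_def vtop_diff)
  have lower: "(norm h)\<^sup>2 \<le> 2 * ((norm (u x z *v f))\<^sup>2 + (norm (u x z *v g))\<^sup>2)" if "x \<ge> 0" for x
  proof -
    have "(norm h)\<^sup>2 \<le> - jquad (u x z *v h)"
      using jquad_u_le[of x z h] that assms(1) jh by simp
    also have "\<dots> \<le> (norm (u x z *v h))\<^sup>2" by (simp add: jquad_def norm_vtop_vbot)
    also have "u x z *v h = u x z *v f - u x z *v g" by (simp add: h_def matrix_vector_mult_diff_distrib)
    also have "(norm \<dots>)\<^sup>2 \<le> (norm (u x z *v f) + norm (u x z *v g))\<^sup>2"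
      by (intro power_mono norm_triangle_ineq4) auto
    also have "\<dots> \<le> 2 * ((norm (u x z *v f))\<^sup>2 + (norm (u x z *v g))\<^sup>2)"
      using zero_le_power2[of "norm (u x z *v f) - norm (u x z *v g)"]
      by (simp add: power2_sum power2_diff)
    finally show ?thesis .
  qed
  obtain N1 where N1: "negligible N1" "\<And>x b. x \<in> {0..b} - N1 \<Longrightarrow>
    \<exists>D \<le> - 2 * (Im z - M) * (norm (u x z *v f))\<^sup>2.
      ((\<lambda>x. jquad (u x z *v f)) has_real_derivative D) (at x within {0..b})"
    by (rule jquad_deriv[of z f]) blast
  obtain N2 where N2: "negligible N2" "\<And>x b. x \<in> {0..b} - N2 \<Longrightarrow>
    \<exists>D \<le> - 2 * (Im z - M) * (norm (u x z *v g))\<^sup>2.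
      ((\<lambda>x. jquad (u x z *v g)) has_real_derivative D) (at x within {0..b})"
    by (rule jquad_deriv[of z g]) blast
  \<comment> \<open>By \<open>lower\<close> the sum of both forms decays at least at the rate c
    |h|^2, so adding the linear term keeps \<open>E\<close> nonincreasing. As both forms stay
    nonnegative, c |h|^2 b \<le> E 0 for every b, which takes the place of integrating
    |y|^2.\<close>
  define E where "E x = jquad (u x z *v f) + jquad (u x z *v g) + c * (norm h)\<^sup>2 * x" for x
  have E: "E b \<le> E 0" if "b \<ge> 0" for b
  proof (rule abs_continuous_deriv_nonpos_imp_le[OF _ that negligible_Un[OF N1(1) N2(1)]])
    have "abs_continuous_on_interval 0 b (\<lambda>x. c * (norm h)\<^sup>2 * x)"
      by (rule abs_continuous_on_interval_lipschitz[where L = "\<bar>c * (norm h)\<^sup>2\<bar>"])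
         (simp flip: right_diff_distrib abs_mult)
    then show "abs_continuous_on_interval 0 b E" unfolding E_def
      by (intro abs_continuous_on_interval_add jquad_abs_continuous that)
    fix x assume x: "x \<in> {0..b} - (N1 \<union> N2)"
    obtain D1 where D1: "D1 \<le> - 2 * (Im z - M) * (norm (u x z *v f))\<^sup>2"
      "((\<lambda>x. jquad (u x z *v f)) has_real_derivative D1) (at x within {0..b})"
      using N1(2)[of x b] x by auto
    obtain D2 where D2: "D2 \<le> - 2 * (Im z - M) * (norm (u x z *v g))\<^sup>2"
      "((\<lambda>x. jquad (u x z *v g)) has_real_derivative D2) (at x within {0..b})"
      using N2(2)[of x b] x by auto
    have "c * (norm h)\<^sup>2 \<le> c * (2 * ((norm (u x z *v f))\<^sup>2 + (norm (u x z *v g))\<^sup>2))"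
      using lower[of x] x \<open>c > 0\<close> by (intro mult_left_mono) auto
    then have "D1 + D2 + c * (norm h)\<^sup>2 \<le> 0"
      using D1(1) D2(1) by (simp add: c_def[symmetric] algebra_simps)
    moreover have "(E has_real_derivative D1 + D2 + c * (norm h)\<^sup>2) (at x within {0..b})"
      unfolding E_def using D1(2) D2(2) by (auto intro!: derivative_eq_intros)
    ultimately show "\<exists>D\<le>0. (E has_real_derivative D) (at x within {0..b})" by blast
  qed
  have bound: "c * (norm h)\<^sup>2 * b \<le> E 0" if "b \<ge> 0" for b
    using E[OF that] f[OF that] g[OF that] by (simp add: E_def)
  have "norm h = 0"
  proof (rule ccontr)
    assume "norm h \<noteq> 0"
    then have pos: "c * (norm h)\<^sup>2 > 0" using \<open>c > 0\<close> by simp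
    then obtain n where "E 0 < of_nat n * (c * (norm h)\<^sup>2)" using ex_less_of_nat_mult by blast
    then show False using bound[of "real n"] by (simp add: mult.commute)
  qed
  then show ?thesis by (simp add: h_def)
qed

end

section \<open>Weyl discs\<close>

lemma matrix_inv_mult:
  assumes "invertible A"
  shows "A ** matrix_inv A = mat 1" "matrix_inv A ** A = mat 1"
proof -
  have "\<exists>B. A ** B = mat 1 \<and> B ** A = mat 1" using assms unfolding invertible_def .
  then have "A ** matrix_inv A = mat 1 \<and> matrix_inv A ** A = mat 1"
    unfolding matrix_inv_def by (rule someI_ex)
  then show "A ** matrix_inv A = mat 1" "matrix_inv A ** A = mat 1" by blast+
qed

text \<open>Cramer's rule for the k-th unit vector. It turns the inverse, which is defined by
  choice, into quotients of polynomials in the entries of \<open>A\<close>, so that holomorphy can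
  be read off.\<close>

lemma matrix_inv_cramer:
  fixes A :: "'k::field^'n::finite^'n"
  assumes "invertible A"
  shows "matrix_inv A $ i $ k =
    det (\<chi> r c. if c = i then (if r = k then 1 else 0) else A $ r $ c) / det A"
proof -
  have col: "matrix_inv A *v (\<chi> r. if r = k then 1 else 0) = (\<chi> r. matrix_inv A $ r $ k)"
    by (simp add: vec_eq_iff matrix_vector_mult_def if_distrib[of "\<lambda>x. _ * x"] cong: if_cong)
  have "A *v (matrix_inv A *v (\<chi> r. if r = k then 1 else 0)) = (\<chi> r. if r = k then 1 else 0)"
    by (simp add: matrix_vector_mul_assoc matrix_inv_mult assms)
  moreover have "det A \<noteq> 0" using assms invertible_det_nz by blast
  ultimately show ?thesis
    unfolding col by (subst (asm) cramer) (simp_all add: vec_eq_iff cong: if_cong)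
qed

lemma holomorphic_on_det:
  fixes A :: "complex \<Rightarrow> complex^'n::finite^'n"
  assumes "\<And>i k. (\<lambda>z. A z $ i $ k) holomorphic_on S"
  shows "(\<lambda>z. det (A z)) holomorphic_on S"
  unfolding det_def by (intro holomorphic_intros assms)

lemma holomorphic_on_matrix_mult:
  fixes A :: "complex \<Rightarrow> complex^'n::finite^'m" and B :: "complex \<Rightarrow> complex^'l^'n"
  assumes "\<And>i k. (\<lambda>z. A z $ i $ k) holomorphic_on S" "\<And>i k. (\<lambda>z. B z $ i $ k) holomorphic_on S"
  shows "(\<lambda>z. (A z ** B z) $ i $ k) holomorphic_on S"
  unfolding matrix_matrix_mult_def by (simp, intro holomorphic_intros assms)

lemma holomorphic_on_matrix_inv:
  fixes A :: "complex \<Rightarrow> complex^'n::finite^'n"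
  assumes hol: "\<And>i k. (\<lambda>z. A z $ i $ k) holomorphic_on S" and inv: "\<And>z. z \<in> S \<Longrightarrow> invertible (A z)"
  shows "(\<lambda>z. matrix_inv (A z) $ i $ k) holomorphic_on S"
proof -
  have "(\<lambda>z. (\<chi> r c. if c = i then (if r = k then 1 else 0) else A z $ r $ c) $ r $ c) holomorphic_on S" for r c
    by (cases "c = i"; cases "r = k") (simp_all add: hol)
  then have "(\<lambda>z. det (\<chi> r c. if c = i then (if r = k then 1 else 0) else A z $ r $ c) / det (A z)) holomorphic_on S"
    using inv by (intro holomorphic_on_divide holomorphic_on_det hol) (auto simp: invertible_det_nz)
  then show ?thesis
    by (rule holomorphic_transform) (simp add: matrix_inv_cramer inv)
qed

section \<open>Quotients of block columns and matrix balls\<close>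

lemma block_row_left_vector: "block_row (mat 1) 0 *v y = vtop y"
  and block_row_right_vector: "block_row 0 (mat 1) *v y = vbot y"
  by (simp_all add: vec_eq_iff block_row_def vtop_def vbot_def matrix_vector_mult_def sum_UNIV_sum_type
      mat_def if_distrib[of "\<lambda>x. x * _"] cong: if_cong)

lemma upper_part_vector: "upper_part U Q *v f = vtop (matrix_inv U *v (Q *v f))"
  and lower_part_vector: "lower_part U Q *v f = vbot (matrix_inv U *v (Q *v f))"
  by (simp_all add: upper_part_def lower_part_def block_row_left_vector block_row_right_vector
      flip: matrix_vector_mul_assoc)

text \<open>The classical matrix ball [I \<phi>^*] U^* j U [I; \<phi>] \<ge> 0, tested on vectors.
  It makes no reference to functions of \<open>z\<close>.\<close>

definition weyl_disc :: "complex^('a::finite + 'b::finite)^('a + 'b) \<Rightarrow> (complex^'a^'b) set" where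
  "weyl_disc U = {\<phi>. \<forall>f. 0 \<le> jquad (U *v vjoin f (\<phi> *v f))}"

definition graph_matrix :: "complex^'a^'b \<Rightarrow> complex^'a^('a::finite + 'b::finite)" where
  "graph_matrix \<phi> = (\<chi> r i. case r of Inl k \<Rightarrow> mat 1 $ k $ i | Inr k \<Rightarrow> \<phi> $ k $ i)"

lemma graph_matrix_vector: "graph_matrix \<phi> *v f = vjoin f (\<phi> *v f)"
  by (rule eq_vtop_vbotI)
     (simp_all add: vec_eq_iff graph_matrix_def vtop_def vbot_def vjoin_def matrix_vector_mult_def
      mat_def if_distrib[of "\<lambda>x. x * _"] cong: if_cong)

text \<open>If the upper half of y = U^{-1} Q f vanishes, then \<open>jquad y\<close> is minus the
  squared norm of the lower half, while 0 \<le> jquad (U y) \<le> jquad y. Hence y = 0, and f = 0 by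
  injectivity of \<open>Q\<close>.\<close>

lemma invertible_upper_part:
  assumes U: "invertible U" "\<And>g. jquad (U *v g) \<le> jquad g" and Q: "P_ineq Q"
  shows "invertible (upper_part U Q)"
proof -
  have "f = 0" if "upper_part U Q *v f = 0" for f
  proof -
    let ?y = "matrix_inv U *v (Q *v f)"
    have Uy: "U *v ?y = Q *v f" by (simp add: matrix_vector_mul_assoc matrix_mul_assoc matrix_inv_mult U)
    have top: "vtop ?y = 0" using that by (simp add: upper_part_vector)
    have "0 \<le> jquad (U *v ?y)" using Q by (simp add: Uy P_ineq_iff)
    then have "0 \<le> jquad ?y" using U(2)[of ?y] by linarith
    then have "vbot ?y = 0" by (simp add: jquad_def top)
    then have "?y = 0" using top by (intro eq_vtop_vbotI) auto
    then have "Q *v f = 0" using Uy by simp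
    then show "f = 0" using Q by (auto simp: P_ineq_iff)
  qed
  then have "inj ((*v) (upper_part U Q))"
    by (intro injI) (metis eq_iff_diff_eq_0 matrix_vector_mult_diff_distrib)
  then show ?thesis by (simp add: invertible_left_inverse matrix_left_invertible_injective)
qed

text \<open>The quotient is the matrix whose graph is the range of U^{-1} Q, so \<open>U\<close>
  maps this graph into the \<open>j\<close>-nonnegative range of \<open>Q\<close>.\<close>

lemma quotient_in_weyl_disc:
  assumes U: "invertible U" "\<And>g. jquad (U *v g) \<le> jquad g" and Q: "P_ineq Q"
  shows "lower_part U Q ** matrix_inv (upper_part U Q) \<in> weyl_disc U"
  unfolding weyl_disc_def
proof (intro CollectI allI)
  fix g
  define f where "f = matrix_inv (upper_part U Q) *v g"
  have inv: "invertible (upper_part U Q)" by (rule invertible_upper_part[OF assms])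
  have "upper_part U Q *v f = g"
    by (simp add: f_def matrix_vector_mul_assoc matrix_inv_mult inv)
  moreover have "(lower_part U Q ** matrix_inv (upper_part U Q)) *v g = lower_part U Q *v f"
    by (simp add: f_def flip: matrix_vector_mul_assoc)
  ultimately have "vjoin g ((lower_part U Q ** matrix_inv (upper_part U Q)) *v g) = matrix_inv U *v (Q *v f)"
    by (metis upper_part_vector lower_part_vector vjoin_vtop_vbot)
  then have "U *v vjoin g ((lower_part U Q ** matrix_inv (upper_part U Q)) *v g) = Q *v f"
    by (simp add: matrix_vector_mul_assoc matrix_mul_assoc matrix_inv_mult U)
  then show "0 \<le> jquad (U *v vjoin g ((lower_part U Q ** matrix_inv (upper_part U Q)) *v g))"
    using Q by (simp add: P_ineq_iff)
qed

lemma P_ineq_graph_matrix: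
  assumes "invertible U" "\<phi> \<in> weyl_disc U"
  shows "P_ineq (U ** graph_matrix \<phi>)"
proof -
  have "f = 0" if "(U ** graph_matrix \<phi>) *v f = 0" for f
  proof -
    have "U *v vjoin f (\<phi> *v f) = 0"
      using that by (simp add: graph_matrix_vector flip: matrix_vector_mul_assoc)
    then have "matrix_inv U *v (U *v vjoin f (\<phi> *v f)) = 0" by simp
    then have "vjoin f (\<phi> *v f) = 0" by (simp add: matrix_vector_mul_assoc matrix_inv_mult assms)
    then show "f = 0" by (metis vtop_vjoin vtop_zero)
  qed
  then show ?thesis
    using assms(2) by (auto simp: P_ineq_iff weyl_disc_def graph_matrix_vector simp flip: matrix_vector_mul_assoc)
qed

text \<open>For Q = U [I; \<phi>] the factor \<open>U\<close> cancels, the upper part is the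
  identity and the lower part is \<phi>. So every point of the disc is the quotient of an admissible
  matrix.\<close>

lemma quotient_graph_matrix:
  assumes "invertible U"
  shows "lower_part U (U ** graph_matrix \<phi>) ** matrix_inv (upper_part U (U ** graph_matrix \<phi>)) = \<phi>"
proof -
  have inv: "matrix_inv U *v ((U ** graph_matrix \<phi>) *v f) = vjoin f (\<phi> *v f)" for f
    by (simp add: matrix_vector_mul_assoc matrix_mul_assoc matrix_inv_mult assms graph_matrix_vector)
  have "upper_part U (U ** graph_matrix \<phi>) = mat 1"
    unfolding matrix_eq by (simp only: upper_part_vector inv vtop_vjoin matrix_vector_mul_lid) simp
  moreover have "lower_part U (U ** graph_matrix \<phi>) = \<phi>"
    unfolding matrix_eq by (simp only: lower_part_vector inv vbot_vjoin) simp
  moreover have "matrix_inv (mat 1 :: complex^'a^'a) = mat 1"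
    using matrix_inv_mult(1)[of "mat 1 :: complex^'a^'a"] by (simp add: invertible_def)
  ultimately show ?thesis by simp
qed

text \<open>Both the point and the disc may vary: at a singularity the approximating values belong
  to discs at nearby spectral parameters. With \<open>U\<close> constant this is the closedness of a
  single disc, used for subsequences.\<close>

lemma weyl_disc_tendsto:
  fixes U :: "'c \<Rightarrow> complex^('a::finite + 'b::finite)^('a + 'b)"
  assumes U: "(U \<longlongrightarrow> U') F" and \<phi>: "(\<phi> \<longlongrightarrow> \<phi>') F"
    and ev: "eventually (\<lambda>w. \<phi> w \<in> weyl_disc (U w)) F" and "F \<noteq> bot"
  shows "\<phi>' \<in> weyl_disc U'"
  unfolding weyl_disc_def
proof (intro CollectI allI)
  fix f
  have mv: "((\<lambda>w. A w *v g w) \<longlongrightarrow> A' *v g') F"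
    if "(A \<longlongrightarrow> A') F" "(g \<longlongrightarrow> g') F"
    for A :: "'c \<Rightarrow> complex^'n::finite^'m::finite" and A' g g'
    by (rule vec_tendstoI) (simp add: matrix_vector_mult_def, intro tendsto_intros that)
  have "((\<lambda>w. vjoin f (\<phi> w *v f)) \<longlongrightarrow> vjoin f (\<phi>' *v f)) F"
  proof (rule vec_tendstoI)
    fix r
    show "((\<lambda>w. vjoin f (\<phi> w *v f) $ r) \<longlongrightarrow> vjoin f (\<phi>' *v f) $ r) F"
      by (cases r) (auto simp: vjoin_def intro!: tendsto_vec_nth mv \<phi>)
  qed
  then have "((\<lambda>w. jquad (U w *v vjoin f (\<phi> w *v f))) \<longlongrightarrow> jquad (U' *v vjoin f (\<phi>' *v f))) F"
    unfolding jquad_eq_inner by (intro tendsto_intros mv U)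
  moreover have "eventually (\<lambda>w. 0 \<le> jquad (U w *v vjoin f (\<phi> w *v f))) F"
    using ev by eventually_elim (simp add: weyl_disc_def)
  ultimately show "0 \<le> jquad (U' *v vjoin f (\<phi>' *v f))"
    using \<open>F \<noteq> bot\<close> by (rule tendsto_lowerbound)
qed

context dirac_system
begin

section \<open>Nested discs and the sets of values\<close>

lemma weyl_disc_antimono:
  assumes "0 \<le> s" "s \<le> t" "M \<le> Im z"
  shows "weyl_disc (u t z) \<subseteq> weyl_disc (u s z)"
  unfolding weyl_disc_def using jquad_antimono[OF assms] order_trans by blast

text \<open>The disc at x = 0 is the set of all contractions, and it contains all later
  ones.\<close>

lemma weyl_disc_contraction:
  assumes "\<phi> \<in> weyl_disc (u x z)" "0 \<le> x" "M \<le> Im z"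
  shows "norm (\<phi> *v f) \<le> norm f"
proof -
  have "\<phi> \<in> weyl_disc (u 0 z)" using weyl_disc_antimono[of 0 x z] assms by blast
  then have "0 \<le> jquad (vjoin f (\<phi> *v f))" by (simp add: weyl_disc_def u_zero)
  then show ?thesis by (simp add: jquad_def)
qed

lemma weyl_disc_entry_le:
  fixes \<phi> :: "complex^'a^'b"
  assumes "\<phi> \<in> weyl_disc (u x z)" "0 \<le> x" "M \<le> Im z"
  shows "norm (\<phi> $ i $ k) \<le> 1"
proof -
  have "\<phi> $ i $ k = (\<phi> *v axis k 1) $ i"
    by (simp add: matrix_vector_mult_def axis_def if_distrib[of "\<lambda>x. _ * x"] cong: if_cong)
  also have "norm \<dots> \<le> norm (\<phi> *v axis k 1)" by (rule Finite_Cartesian_Product.norm_nth_le)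
  also have "\<dots> \<le> norm (axis k 1 :: complex^'a)" by (rule weyl_disc_contraction[OF assms])
  finally show ?thesis by (simp add: norm_eq_sqrt_inner inner_axis_axis)
qed

lemma phi_in_weyl_disc:
  assumes "0 \<le> x" "M \<le> Im z" "P_ineq (P z)"
  shows "phi u x z P \<in> weyl_disc (u x z)"
  unfolding phi_def using assms by (intro quotient_in_weyl_disc invertible_u jquad_u_le)

lemma phi_holomorphic:
  fixes P :: "complex \<Rightarrow> complex^'a^('a + 'b)"
  assumes "0 \<le> x" and "\<And>w. w \<in> S \<Longrightarrow> M \<le> Im w" "\<And>w. w \<in> S \<Longrightarrow> P_ineq (P w)"
    and P: "\<And>i k. (\<lambda>w. P w $ i $ k) holomorphic_on S"
  shows "(\<lambda>w. phi u x w P $ i $ k) holomorphic_on S"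
  unfolding phi_def lower_part_def upper_part_def
  using assms invertible_upper_part[OF invertible_u jquad_u_le]
  by (intro holomorphic_on_matrix_mult holomorphic_on_matrix_inv u_holomorphic P)
     (auto simp: invertible_u upper_part_def)

lemma N_set_eq_weyl_disc:
  assumes z: "z \<in> upper_halfplane M" and x: "0 \<le> x"
  shows "N_set M u x z = weyl_disc (u x z)"
proof
  have op: "open (upper_halfplane M)"
    unfolding upper_halfplane_def by (intro open_Collect_less continuous_intros)
  have im: "M \<le> Im w" if "w \<in> upper_halfplane M" for w
    using that by (simp add: upper_halfplane_def)
  show "weyl_disc (u x z) \<subseteq> N_set M u x z"
  proof
    fix \<phi> assume \<phi>: "\<phi> \<in> weyl_disc (u x z)"
    \<comment> \<open>\<open>P\<close> is constant in the spectral variable but built from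
      \<open>u\<close> at the given point \<open>z\<close>. Its quotient at other points need not be
      \<phi>; it is holomorphic, so removing singularities leaves the value at \<open>z\<close>,
      which is \<phi>.\<close>
    define P :: "complex \<Rightarrow> complex^'a^('a + 'b)" where "P = (\<lambda>_. u x z ** graph_matrix \<phi>)"
    have ineq: "P_ineq (P w)" for w
      unfolding P_def using \<phi> x by (intro P_ineq_graph_matrix invertible_u)
    then have "P \<in> P_class M" 
      by (simp add: P_class_def P_def analytic_on_imp_meromorphic_on)
    moreover have "remove_sings (\<lambda>w. phi u x w P $ i $ k) z = \<phi> $ i $ k" for i k
    proof -
      have "(\<lambda>w. phi u x w P $ i $ k) holomorphic_on upper_halfplane M"
        using im ineq x by (intro phi_holomorphic) (auto simp: P_def)
      then have "(\<lambda>w. phi u x w P $ i $ k) analytic_on {z}"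
        using z op analytic_on_open analytic_on_subset by blast
      then show ?thesis
        using quotient_graph_matrix[OF invertible_u[OF x]] by (simp add: phi_def P_def)
    qed
    ultimately show "\<phi> \<in> N_set M u x z"
      unfolding N_set_def by (intro CollectI exI[of _ P]) (simp add: vec_eq_iff)
  qed
  show "N_set M u x z \<subseteq> weyl_disc (u x z)"
  proof
    fix \<Phi> assume "\<Phi> \<in> N_set M u x z"
    then obtain P where P: "P \<in> P_class M"
      and \<Phi>: "\<Phi> = (\<chi> i k. remove_sings (\<lambda>\<zeta>. phi u x \<zeta> P $ i $ k) z)"
      unfolding N_set_def by blast
    have "eventually (\<lambda>w. (\<lambda>w. P w $ i $ k) analytic_on {w}) (at z)" for i k
    proof -
      have "(\<lambda>w. P w $ i $ k) meromorphic_on {z}"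
        using P z unfolding P_class_def by (auto intro: meromorphic_on_subset)
      then show ?thesis by (simp add: meromorphic_at_iff flip: isolated_singularity_at_altdef)
    qed
    then have "eventually (\<lambda>w. \<forall>i k. (\<lambda>w. P w $ i $ k) analytic_on {w}) (at z)"
      by (intro eventually_all_finite)
    moreover have "eventually (\<lambda>w. P_ineq (P w)) (at z)"
      using P z unfolding P_class_def by (auto simp: eventually_cosparse_open_eq[OF op])
    moreover have "eventually (\<lambda>w. w \<in> upper_halfplane M) (at z)"
      using op z by (rule eventually_at_in_open')
    ultimately have "eventually (\<lambda>w. (\<forall>i k. (\<lambda>w. P w $ i $ k) analytic_on {w}) \<and> P_ineq (P w) \<and>
        w \<in> upper_halfplane M) (at z)"
      by eventually_elim blast
    then obtain r where r: "r > 0" "\<And>w. w \<in> ball z r - {z} \<Longrightarrow>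
        (\<forall>i k. (\<lambda>w. P w $ i $ k) analytic_on {w}) \<and> P_ineq (P w) \<and> w \<in> upper_halfplane M"
      unfolding eventually_at by (auto simp: dist_commute)
    have disc: "phi u x w P \<in> weyl_disc (u x w)" if "w \<in> ball z r - {z}" for w
      using r(2)[OF that] im x by (intro phi_in_weyl_disc) auto
    have ev: "eventually (\<lambda>w. w \<in> ball z r - {z}) (at z)"
      using r(1) eventually_at_ball'[of r z UNIV] by (auto elim: eventually_mono)
    \<comment> \<open>Riemann's theorem: near \<open>z\<close> the entries are holomorphic on a
      punctured ball and bounded by 1, since they belong to contractions. Therefore
      \<open>remove_sings\<close> yields the actual limit.\<close>
    have lim: "((\<lambda>w. phi u x w P $ i $ k) \<longlongrightarrow> \<Phi> $ i $ k) (at z)" for i k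
    proof -
      have hol: "(\<lambda>w. phi u x w P $ i $ k) holomorphic_on ball z r - {z}"
        using r(2) im x
        by (intro phi_holomorphic) (auto intro!: analytic_imp_holomorphic simp: analytic_on_def analytic_at)
      have "eventually (\<lambda>w. norm (phi u x w P $ i $ k) \<le> 1) (at z)"
        using ev
      proof eventually_elim
        case (elim w)
        then show ?case using r(2)[OF elim] im x by (intro weyl_disc_entry_le[OF disc]) auto
      qed
      then obtain g where g: "g holomorphic_on ball z r" "\<And>w. w \<in> ball z r - {z} \<Longrightarrow> g w = phi u x w P $ i $ k"
        using holomorphic_on_extend_bounded[OF hol] r(1) by (auto simp: interior_open)
      have "isCont g z"
        using holomorphic_on_imp_continuous_on[OF g(1)] r(1) by (simp add: continuous_on_eq_continuous_at)
      then have "(g \<longlongrightarrow> g z) (at z)" by (rule isContD)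
      then have "((\<lambda>w. phi u x w P $ i $ k) \<longlongrightarrow> g z) (at z)"
        by (rule Lim_transform_eventually) (use ev g(2) in \<open>auto elim: eventually_mono\<close>)
      then show ?thesis by (simp add: \<Phi> remove_sings_eqI)
    qed
    show "\<Phi> \<in> weyl_disc (u x z)"
    proof (rule weyl_disc_tendsto)
      \<comment> \<open>This is where analyticity of \<open>u\<close> in \<open>z\<close> enters:
        the discs containing the approximating values converge to the disc at
        \<open>z\<close>.\<close>
      have "isCont (\<lambda>w. u x w $ i $ k) z" for i k
        using holomorphic_on_imp_continuous_on[OF u_holomorphic[OF x, of i k UNIV]]
        by (simp add: continuous_on_eq_continuous_at)
      then show "(u x \<longlongrightarrow> u x z) (at z)"
        by (intro vec_tendstoI isContD)
      show "((\<lambda>w. phi u x w P) \<longlongrightarrow> \<Phi>) (at z)" by (intro vec_tendstoI lim)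
      show "eventually (\<lambda>w. phi u x w P \<in> weyl_disc (u x w)) (at z)"
        using ev by eventually_elim (rule disc)
    qed simp
  qed
qed

section \<open>The limit point and its analyticity\<close>

lemma weyl_disc_Inter_unique:
  fixes \<phi> \<psi> :: "complex^'a^'b"
  assumes "M < Im z" and \<phi>: "\<And>x. x \<ge> 0 \<Longrightarrow> \<phi> \<in> weyl_disc (u x z)" and \<psi>: "\<And>x. x \<ge> 0 \<Longrightarrow> \<psi> \<in> weyl_disc (u x z)"
  shows "\<phi> = \<psi>"
  unfolding matrix_eq
proof
  fix f
  have "vjoin f (\<phi> *v f) = vjoin f (\<psi> *v f)"
    using \<phi> \<psi> by (intro jquad_nonneg_unique[OF assms(1)]) (auto simp: weyl_disc_def)
  then show "\<phi> *v f = \<psi> *v f" by (metis vbot_vjoin)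
qed

text \<open>Bolzano-Weierstrass for points in nested closed discs. The index map \<open>r\<close> is
  there because the lemma serves twice: with r n = n for existence, and along the subsequence that
  Montel's theorem selects.\<close>

lemma weyl_disc_subsequence:
  fixes \<Phi> :: "nat \<Rightarrow> complex^'a^'b"
  assumes "M \<le> Im z" and \<Phi>: "\<And>n. \<Phi> n \<in> weyl_disc (u (real (r n)) z)" and r: "strict_mono r"
  obtains L s where "strict_mono s" "(\<Phi> \<circ> s) \<longlonglongrightarrow> L" "\<And>x. x \<ge> 0 \<Longrightarrow> L \<in> weyl_disc (u x z)"
proof -
  have "norm (\<Phi> n) \<le> (\<Sum>i\<in>(UNIV :: 'b set). \<Sum>k\<in>(UNIV :: 'a set). 1)" for n
  proof -
    have "norm (\<Phi> n) \<le> (\<Sum>i\<in>UNIV. norm (\<Phi> n $ i))"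
      unfolding norm_vec_def[of "\<Phi> n"] by (rule L2_set_le_sum) simp
    also have "\<dots> \<le> (\<Sum>i\<in>UNIV. \<Sum>k\<in>UNIV. norm (\<Phi> n $ i $ k))"
      unfolding norm_vec_def[of "\<Phi> n $ _"] by (intro sum_mono L2_set_le_sum) simp
    also have "\<dots> \<le> (\<Sum>i\<in>(UNIV :: 'b set). \<Sum>k\<in>(UNIV :: 'a set). 1)"
      using weyl_disc_entry_le[OF \<Phi>] assms(1) by (intro sum_mono) auto
    finally show ?thesis .
  qed
  then have "bounded (range \<Phi>)" unfolding bounded_iff by blast
  then obtain L s where s: "strict_mono s" "(\<Phi> \<circ> s) \<longlonglongrightarrow> L"
    using bounded_imp_convergent_subsequence by blast
  have "L \<in> weyl_disc (u x z)" if "x \<ge> 0" for x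
  proof (rule weyl_disc_tendsto[OF tendsto_const s(2)])
    obtain n0 where n0: "x \<le> real n0" using real_arch_simple by blast
    show "eventually (\<lambda>n. (\<Phi> \<circ> s) n \<in> weyl_disc (u x z)) sequentially"
      using eventually_ge_at_top[of n0]
    proof eventually_elim
      case (elim n)
      have "n \<le> r (s n)"
        using seq_suble[OF s(1), of n] seq_suble[OF r, of "s n"] by linarith
      then have "x \<le> real (r (s n))" using n0 elim by linarith
      then show ?case using weyl_disc_antimono[OF that _ assms(1)] \<Phi>[of "s n"] by auto
    qed
  qed simp
  with s show ?thesis by (rule that)
qed

text \<open>A choice of a point in the disc at x = n that depends holomorphically on
  \<open>z\<close>, obtained from the constant block column [I; 0], on which \<open>jquad\<close>
  equals |f|^2.\<close>

definition weyl_approx :: "nat \<Rightarrow> complex \<Rightarrow> complex^'a^'b" where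
  "weyl_approx n z = phi u (real n) z (\<lambda>_. graph_matrix 0)"

lemma P_ineq_graph_zero: "P_ineq (graph_matrix 0 :: complex^'a^('a + 'b))"
  using P_ineq_graph_matrix[of "mat 1" "0 :: complex^'a^'b"]
  by (simp add: invertible_def weyl_disc_def jquad_def)

lemma weyl_approx_in_weyl_disc: "M \<le> Im z \<Longrightarrow> weyl_approx n z \<in> weyl_disc (u (real n) z)"
  unfolding weyl_approx_def by (intro phi_in_weyl_disc P_ineq_graph_zero) auto

lemma weyl_disc_Inter_ex1:
  assumes "M < Im z" shows "\<exists>!\<phi>. \<forall>x\<ge>0. \<phi> \<in> weyl_disc (u x z)"
proof -
  have "\<exists>L. \<forall>x\<ge>0. L \<in> weyl_disc (u x z)"
    using weyl_disc_subsequence[of z "\<lambda>n. weyl_approx n z" "\<lambda>n. n"] weyl_approx_in_weyl_disc assms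
    by (metis less_imp_le strict_mono_id[unfolded id_def])
  then show ?thesis using weyl_disc_Inter_unique[OF assms] by blast
qed

text \<open>The hypothesis describes \<phi> separately at each \<open>z\<close>, so analyticity must
  come from approximants. Montel's theorem applies to one entry at a time, with a subsequence
  depending on that entry; uniqueness of the intersection point identifies its limit with the entry
  of \<phi>.\<close>

lemma weyl_function_holomorphic:
  fixes \<phi> :: "complex \<Rightarrow> complex^'a^'b"
  assumes \<phi>: "\<And>z x. M < Im z \<Longrightarrow> x \<ge> 0 \<Longrightarrow> \<phi> z \<in> weyl_disc (u x z)"
  shows "(\<lambda>z. \<phi> z $ i $ k) holomorphic_on upper_halfplane M"
proof -
  let ?C = "upper_halfplane M"
  have im: "M < Im w" if "w \<in> ?C" for w using that by (simp add: upper_halfplane_def)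
  have op: "open ?C" unfolding upper_halfplane_def by (intro open_Collect_less continuous_intros)
  have "(\<lambda>z. weyl_approx n z $ i $ k) holomorphic_on ?C" for n
    unfolding weyl_approx_def using im P_ineq_graph_zero
    by (intro phi_holomorphic) (auto intro: less_imp_le)
  moreover have le: "norm (weyl_approx n z $ i $ k) \<le> 1" if "z \<in> ?C" for n z
    using weyl_disc_entry_le[OF weyl_approx_in_weyl_disc] im[OF that] by (simp add: less_imp_le)
  then have "\<exists>B. \<forall>h\<in>range (\<lambda>n z. weyl_approx n z $ i $ k). \<forall>z\<in>K. norm (h z) \<le> B" if "K \<subseteq> ?C" for K
    using that by (intro exI[of _ 1]) blast
  ultimately obtain g r where g: "g holomorphic_on ?C" "strict_mono (r :: nat \<Rightarrow> nat)"
    "\<And>z. z \<in> ?C \<Longrightarrow> (\<lambda>n. weyl_approx (r n) z $ i $ k) \<longlonglongrightarrow> g z"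
    using Montel[OF op, of "range (\<lambda>n z. weyl_approx n z $ i $ k)" "\<lambda>n z. weyl_approx n z $ i $ k"]
    by (smt (verit) image_iff order_refl)
  have "g z = \<phi> z $ i $ k" if z: "z \<in> ?C" for z
  proof -
    have "M \<le> Im z" using im[OF z] by simp
    \<comment> \<open>The further subsequence makes the whole matrix converge and may depend on
      \<open>z\<close>; it serves only to compute \<open>g z\<close>.\<close>
    then obtain L s where L: "strict_mono s" "((\<lambda>n. weyl_approx (r n) z) \<circ> s) \<longlonglongrightarrow> L" "\<And>x. x \<ge> 0 \<Longrightarrow> L \<in> weyl_disc (u x z)"
      using weyl_disc_subsequence[of z "\<lambda>n. weyl_approx (r n) z" r] weyl_approx_in_weyl_disc g(2) by metis
    have "L = \<phi> z" using L(3) \<phi> im[OF z] by (intro weyl_disc_Inter_unique[of z]) auto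
    moreover have "(\<lambda>n. weyl_approx (r (s n)) z $ i $ k) \<longlonglongrightarrow> L $ i $ k"
      using L(2) by (intro tendsto_vec_nth) (simp add: o_def)
    moreover have "(\<lambda>n. weyl_approx (r (s n)) z $ i $ k) \<longlonglongrightarrow> g z"
      using LIMSEQ_subseq_LIMSEQ[OF g(3)[OF z] L(1)] by (simp add: o_def)
    ultimately show ?thesis using LIMSEQ_unique by blast
  qed
  then show ?thesis using g(1) by (rule holomorphic_transform[rotated])
qed

end

theorem proposition2p2:
  fixes M :: real
    and v :: "real \<Rightarrow> complex^'b::finite^'a::finite"
    and u :: "real \<Rightarrow> complex \<Rightarrow> complex^('a + 'b)^('a + 'b)"
  assumes "M > 0"
    and "v \<in> borel_measurable (lebesgue_on {0..})"
    and "\<And>x. x \<ge> 0 \<Longrightarrow> onorm (\<lambda>f. v x *v f) \<le> M"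
    and "fundamental_solution v u"
  shows "(\<forall>x\<ge>0. \<forall>z\<in>upper_halfplane M. \<forall>P\<in>P_class M.
            P_ineq (P z) \<longrightarrow> invertible (upper_part (u x z) (P z)))
       \<and> (\<exists>\<phi> :: complex \<Rightarrow> complex^'a^'b.
            (\<forall>z\<in>upper_halfplane M. {\<phi> z} = (\<Inter>x\<in>{0..}. N_set M u x z)) \<and>
            (\<forall>\<psi>. (\<forall>z\<in>upper_halfplane M. {\<psi> z} = (\<Inter>x\<in>{0..}. N_set M u x z)) \<longrightarrow>
                  (\<forall>z\<in>upper_halfplane M. \<psi> z = \<phi> z)) \<and>
            (\<forall>i k. (\<lambda>z. \<phi> z $ i $ k) analytic_on upper_halfplane M) \<and>
            (\<forall>z\<in>upper_halfplane M. pos_semidef (mat 1 - ctranspose (\<phi> z) ** \<phi> z)))"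
proof (intro conjI ballI allI impI)
  interpret dirac_system M v u using assms(3,4) by unfold_locales
  let ?C = "upper_halfplane M"
  have im: "M < Im z" if "z \<in> ?C" for z using that by (simp add: upper_halfplane_def)
  have op: "open ?C" unfolding upper_halfplane_def by (intro open_Collect_less continuous_intros)
  show "invertible (upper_part (u x z) (P z))"
    if "0 \<le> x" "z \<in> ?C" "P_ineq (P z)" for x z and P :: "complex \<Rightarrow> complex^'a^('a + 'b)"
    using that im[of z] by (intro invertible_upper_part invertible_u jquad_u_le) auto
  \<comment> \<open>The description determines a matrix for Im z > M, and \<phi> is evaluated only
    there.\<close>
  define \<phi> where "\<phi> z = (THE \<phi>. \<forall>x\<ge>0. \<phi> \<in> weyl_disc (u x z))" for z
  have \<phi>: "\<phi> z \<in> weyl_disc (u x z)" if "M < Im z" "x \<ge> 0" for x z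
    using theI'[OF weyl_disc_Inter_ex1[OF that(1)]] that(2) unfolding \<phi>_def by blast
  have inter: "{\<phi> z} = (\<Inter>x\<in>{0..}. N_set M u x z)" if z: "z \<in> ?C" for z
  proof -
    have "(\<Inter>x\<in>{0..}. N_set M u x z) = (\<Inter>x\<in>{0..}. weyl_disc (u x z))"
      by (intro INF_cong) (auto simp: N_set_eq_weyl_disc[OF z])
    also have "\<dots> = {\<phi> z}"
      using \<phi>[OF im[OF z]] weyl_disc_Inter_unique[OF im[OF z], of _ "\<phi> z"] by auto
    finally show ?thesis by simp
  qed
  show "\<exists>\<phi> :: complex \<Rightarrow> complex^'a^'b.
      (\<forall>z\<in>?C. {\<phi> z} = (\<Inter>x\<in>{0..}. N_set M u x z)) \<and>
      (\<forall>\<psi>. (\<forall>z\<in>?C. {\<psi> z} = (\<Inter>x\<in>{0..}. N_set M u x z)) \<longrightarrow> (\<forall>z\<in>?C. \<psi> z = \<phi> z)) \<and>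
      (\<forall>i k. (\<lambda>z. \<phi> z $ i $ k) analytic_on ?C) \<and>
      (\<forall>z\<in>?C. pos_semidef (mat 1 - ctranspose (\<phi> z) ** \<phi> z))"
  proof (intro exI[of _ \<phi>] conjI ballI allI impI)
    show "{\<phi> z} = (\<Inter>x\<in>{0..}. N_set M u x z)" if "z \<in> ?C" for z using inter[OF that] .
    show "\<psi> z = \<phi> z" if "\<forall>z\<in>?C. {\<psi> z} = (\<Inter>x\<in>{0..}. N_set M u x z)" "z \<in> ?C" for \<psi> z
      using that inter[OF that(2)] by (metis singleton_inject)
    show "(\<lambda>z. \<phi> z $ i $ k) analytic_on ?C" for i k
      using weyl_function_holomorphic[of \<phi> i k] \<phi> op by (simp add: analytic_on_open)
    show "pos_semidef (mat 1 - ctranspose (\<phi> z) ** \<phi> z)" if "z \<in> ?C" for z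
      using weyl_disc_contraction[OF \<phi>[of z 0]] im[OF that]
      by (simp add: pos_semidef_def cform_one_minus_gram less_eq_complex_def power_mono)
  qed
qed

end
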